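(* Let $h,G,R,\rho,C,L,\tau,u^0,(u^k)_{k\ge 0}$ be as described in the context, so that all of the listed basic assumptions, Assumptions A and Assumptions B hold. Let $z^*:=\lim_{k\to\infty}\rho(u^k)$ be the limit of the outer sequence (which exists, and lies in $\operatorname{int}\operatorname{dom}h$, under these assumptions). Suppose in addition that the subproblems are solved to global optimality, i.e. $E_{u^k}(u^{k+1})\le E_{u^k}(u)$ for all $u\in\mathbb R^n$ and all $k\ge0$. Then every $u^*\in\operatorname{accum}(u^0)$ is $R$-minimizing with respect to $\rho(u)=z^*$, i.e. $\rho(u^* )=z^*$ and $$R(u^* )=\min\{R(u): u\in\mathbb R^n,\ \rho(u)=z^*\}.$$ In particular, if the $R$-minimizing element with respect to $\rho(u)=z^*$ is unique, then the whole sequence of iterates $(u^k)$ converges.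
   Context: Notation. $\overline{\mathbb R}=\mathbb R\cup\{+\infty\}$; for $f:\mathbb R^d\to\overline{\mathbb R}$, $\operatorname{dom}f=\{x: f(x)<\infty\}$; $f$ is proper if $\operatorname{dom}f\ne\emptyset$; lower semi-continuous means $\liminf_{x\to\bar x}f(x)\ge f(\bar x)$ for all $\bar x$. $\operatorname{dist}(u,S)=\inf_{x\in S}\|u-x\|$ (equal to $+\infty$ if $S=\emptyset$). A proper convex $h$ is essentially smooth if its convex subdifferential is locally bounded and single-valued on its domain; then the domain of the subdifferential is $\operatorname{int}\operatorname{dom}h\neq\emptyset$ and $h$ is differentiable there. Basic assumptions. $C\subset\mathbb R^m$ is closed and convex with $\operatorname{int}C\ne\emptyset$. $h:\mathbb R^m\to\overline{\mathbb R}$ is proper, lower semi-continuous, convex, essentially smooth, with $\overline{\operatorname{dom}h}=C$. $G:\mathbb R^m\to\overline{\mathbb R}$ is proper, lower semi-continuous, $\operatorname{dom}h\subset\operatorname{dom}G$, and $G$ is differentiable on $\operatorname{int}\operatorname{dom}h$. $R:\mathbb R^n\to\overline{\mathbb R}$ is proper, lower semi-continuous and $\operatorname{dom}R\cap\rho^{-1}(\operatorname{int}\operatorname{dom}h)\neq\emptyset$. $\rho:\mathbb R^n\to\mathbb R^m$ is continuous. The objective is $E(u)=G(\rho(u))+R(u)$, to be minimized over $\Delta=\rho^{-1}(C)$. Bregman distance: $D_h(x,y)=h(x)-h(y)-\langle\nabla h(y),x-y\rangle$ for $x\in\mathbb R^m$, $y\in\operatorname{int}\operatorname{dom}h$ (and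 $D_h(x,y)=\infty$ if $y\notin\operatorname{int}\operatorname{dom}h$). For a step size $\tau>0$ and a point $u^k$ with $\rho(u^k)\in\operatorname{int}\operatorname{dom}h$, $$E_{u^k}(u)=\tfrac1\tau D_h(\rho(u),\rho(u^k))+G(\rho(u^k))+\langle\nabla G(\rho(u^k)),\rho(u)-\rho(u^k)\rangle+R(u).$$ Assumptions A. $E$ is bounded from below and coercive ($E(u)\to\infty$ as $\|u\|\to\infty$); $L>0$ and $Lh-G$ is convex on $\operatorname{int}\operatorname{dom}h$; $u^0\in\rho^{-1}(\operatorname{int}\operatorname{dom}h)\cap\operatorname{dom}E$, and for all $k\ge0$: $E_{u^k}(u^{k+1})\le E_{u^k}(u^k)=E(u^k)$ and $u^{k+1}\in\rho^{-1}(\operatorname{int}\operatorname{dom}h)$. Subdifferentials. For $f:\mathbb R^n\to\overline{\mathbb R}$ and $\bar u\in\operatorname{dom}f$, $v\in\hat\partial f(\bar u)$ iff $\liminf_{u\to\bar u,u\ne\bar u}\frac{f(u)-f(\bar u)-\langle v,u-\bar u\rangle}{\|u-\bar u\|}\ge0$; $v\in\partial f(\bar u)$ (limiting subgradient) iff there are $u^i\to\bar u$ with $f(u^i)\to f(\bar u)$ and $v^i\in\hat\partial f(u^i)$ with $v^i\to v$. $\partial f(\bar u)=\emptyset$ for $\bar u\notin\operatorname{dom}f$. Kurdyka-Łojasiewicz (KŁ) property of $E$ at $\bar u\in\operatorname{dom}E$: there exist $\eta>0$, $\varphi\in C^0[0,\eta)\cap C^1(0,\eta)$ with $\varphi(0)=0$,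 $\varphi$ concave, $\varphi'>0$, and a neighborhood $U$ of $\bar u$ such that $\varphi'(E(u)-E(\bar u))\operatorname{dist}(0,\partial E(u))\ge1$ for all $u\in U$ with $E(\bar u)<E(u)<E(\bar u)+\eta$. $\operatorname{accum}(u^0)$ is the set of all limits of convergent subsequences of $(u^k)$. Assumptions B. $E$ is continuous on its domain and satisfies the KŁ property at every point of $\operatorname{accum}(u^0)$; $h$ is strongly convex on $\operatorname{int}\operatorname{dom}h$ (with some modulus $>0$); $\rho$ is continuously differentiable; $\frac1\tau\nabla h-\nabla G$ is locally Lipschitz continuous on $\operatorname{int}\operatorname{dom}h$; with $Z=\{\rho(u^k):k\ge1\}$, the closure $\overline Z$ is contained in $\operatorname{int}\operatorname{dom}h$; $0\in\partial E_{u^k}(u^{k+1})$ for every $k\ge 0$, and $0<\tau<\frac1L$. *)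

theory Defs
  imports "HOL-Analysis.Analysis"
begin

text \<open>
  Functions into \<open>\<real> \<union> {+\<infinity>}\<close> are functions into \<^typ>\<open>ereal\<close> that avoid \<open>-\<infinity>\<close>; this
  restriction on the codomain is part of \<open>proper\<close> below.
\<close>

definition edom :: "('a \<Rightarrow> ereal) \<Rightarrow> 'a set" where
  "edom f = {x. f x < \<infinity>}"

definition proper :: "('a \<Rightarrow> ereal) \<Rightarrow> bool" where
  "proper f \<longleftrightarrow> (\<forall>x. f x \<noteq> -\<infinity>) \<and> edom f \<noteq> {}"

definition lower_semicontinuous :: "('a::topological_space \<Rightarrow> ereal) \<Rightarrow> bool" where
  "lower_semicontinuous f \<longleftrightarrow> (\<forall>x. Liminf (at x) f \<ge> f x)"

definition econvex :: "('a::real_vector \<Rightarrow> ereal) \<Rightarrow> bool" where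
  "econvex f \<longleftrightarrow> (\<forall>x y. \<forall>t\<in>{0..1}.
     f ((1 - t) *\<^sub>R x + t *\<^sub>R y) \<le> ereal (1 - t) * f x + ereal t * f y)"

definition bounded_from_below :: "('a \<Rightarrow> ereal) \<Rightarrow> bool" where
  "bounded_from_below f \<longleftrightarrow> (\<exists>c::real. \<forall>x. ereal c \<le> f x)"

definition coercive :: "('a::real_normed_vector \<Rightarrow> ereal) \<Rightarrow> bool" where
  "coercive f \<longleftrightarrow> (f \<longlongrightarrow> \<infinity>) at_infinity"

definition convex_subdiff :: "('a::real_inner \<Rightarrow> ereal) \<Rightarrow> 'a \<Rightarrow> 'a set" where
  "convex_subdiff f x = {v. x \<in> edom f \<and> (\<forall>y. f x + ereal (v \<bullet> (y - x)) \<le> f y)}"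

text \<open>
  The Bauschke--Borwein notion: the convex subdifferential is locally bounded and single-valued
  on its own domain. It is only used for proper convex functions, for which it implies
  differentiability on the interior of the domain.
\<close>

definition essentially_smooth :: "('a::real_inner \<Rightarrow> ereal) \<Rightarrow> bool" where
  "essentially_smooth f \<longleftrightarrow>
     (\<forall>x. convex_subdiff f x \<noteq> {} \<longrightarrow>
        (\<exists>e>0. bounded (\<Union>y\<in>ball x e. convex_subdiff f y)) \<and>
        (\<exists>!v. v \<in> convex_subdiff f x))"

text \<open>
  Differentiability and gradients are taken through \<^const>\<open>real_of_ereal\<close>; this is only
  meaningful at interior points of the domain, where the function is finite nearby.
\<close>

definition ediff :: "('a::real_normed_vector \<Rightarrow> ereal) \<Rightarrow> 'a \<Rightarrow> bool" where
  "ediff f x \<longleftrightarrow> (\<lambda>y. real_of_ereal (f y)) differentiable (at x)"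

definition egrad :: "('a::real_inner \<Rightarrow> ereal) \<Rightarrow> 'a \<Rightarrow> 'a" where
  "egrad f x = (THE g. GDERIV (\<lambda>y. real_of_ereal (f y)) x :> g)"

definition strongly_convex_on :: "'a::real_normed_vector set \<Rightarrow> real \<Rightarrow> ('a \<Rightarrow> real) \<Rightarrow> bool" where
  "strongly_convex_on S \<mu> f \<longleftrightarrow> convex S \<and>
     (\<forall>x\<in>S. \<forall>y\<in>S. \<forall>t\<in>{0..1}.
        f ((1 - t) *\<^sub>R x + t *\<^sub>R y)
          \<le> (1 - t) * f x + t * f y - \<mu> / 2 * t * (1 - t) * (norm (x - y))\<^sup>2)"

definition locally_lipschitz_on :: "'a::metric_space set \<Rightarrow> ('a \<Rightarrow> 'b::metric_space) \<Rightarrow> bool" where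
  "locally_lipschitz_on S f \<longleftrightarrow> (\<forall>x\<in>S. \<exists>e>0. \<exists>K. K-lipschitz_on (ball x e \<inter> S) f)"

definition continuously_differentiable ::
    "('a::real_normed_vector \<Rightarrow> 'b::real_normed_vector) \<Rightarrow> bool" where
  "continuously_differentiable f \<longleftrightarrow>
     (\<exists>f' :: 'a \<Rightarrow> 'a \<Rightarrow>\<^sub>L 'b.
        (\<forall>x. (f has_derivative blinfun_apply (f' x)) (at x)) \<and> continuous_on UNIV f')"

definition bregman :: "('a::real_inner \<Rightarrow> ereal) \<Rightarrow> 'a \<Rightarrow> 'a \<Rightarrow> ereal" where
  "bregman h x y =
     (if y \<in> interior (edom h) then h x - h y - ereal (egrad h y \<bullet> (x - y)) else \<infinity>)"

definition objective ::
    "('b \<Rightarrow> ereal) \<Rightarrow> ('a \<Rightarrow> ereal) \<Rightarrow> ('a \<Rightarrow> 'b) \<Rightarrow> 'a \<Rightarrow> ereal" where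
  "objective G R \<rho> u = G (\<rho> u) + R u"

text \<open>The surrogate energy \<open>E\<^sub>w\<close> at \<open>u\<close> for the current iterate \<open>w\<close>.\<close>

definition surrogate ::
    "real \<Rightarrow> ('b::real_inner \<Rightarrow> ereal) \<Rightarrow> ('b \<Rightarrow> ereal) \<Rightarrow> ('a \<Rightarrow> ereal) \<Rightarrow> ('a \<Rightarrow> 'b) \<Rightarrow>
     'a \<Rightarrow> 'a \<Rightarrow> ereal" where
  "surrogate \<tau> h G R \<rho> w u =
     ereal (1 / \<tau>) * bregman h (\<rho> u) (\<rho> w) + G (\<rho> w)
       + ereal (egrad G (\<rho> w) \<bullet> (\<rho> u - \<rho> w)) + R u"

definition frechet_subdiff :: "('a::real_inner \<Rightarrow> ereal) \<Rightarrow> 'a \<Rightarrow> 'a set" where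
  "frechet_subdiff f x = {v. x \<in> edom f \<and>
     Liminf (at x) (\<lambda>y. (f y - f x - ereal (v \<bullet> (y - x))) / ereal (norm (y - x))) \<ge> 0}"

definition limiting_subdiff :: "('a::real_inner \<Rightarrow> ereal) \<Rightarrow> 'a \<Rightarrow> 'a set" where
  "limiting_subdiff f x = {v. x \<in> edom f \<and>
     (\<exists>xs vs. xs \<longlonglongrightarrow> x \<and> (\<lambda>i. f (xs i)) \<longlonglongrightarrow> f x \<and>
        (\<forall>i. vs i \<in> frechet_subdiff f (xs i)) \<and> vs \<longlonglongrightarrow> v)}"

text \<open>Unlike \<^const>\<open>infdist\<close>, this distance is \<open>+\<infinity>\<close> for the empty set.\<close>

definition edist_set :: "'a::metric_space \<Rightarrow> 'a set \<Rightarrow> ereal" where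
  "edist_set x S = (INF y\<in>S. ereal (dist x y))"

definition KL_property :: "('a::real_inner \<Rightarrow> ereal) \<Rightarrow> 'a \<Rightarrow> bool" where
  "KL_property f x \<longleftrightarrow> x \<in> edom f \<and>
     (\<exists>\<eta>>0. \<exists>\<phi> :: real \<Rightarrow> real. \<exists>U.
        continuous_on {0..<\<eta>} \<phi> \<and> \<phi> C1_differentiable_on {0<..<\<eta>} \<and>
        \<phi> 0 = 0 \<and> concave_on {0..<\<eta>} \<phi> \<and> (\<forall>s\<in>{0<..<\<eta>}. deriv \<phi> s > 0) \<and>
        open U \<and> x \<in> U \<and>
        (\<forall>u\<in>U. f x < f u \<and> f u < f x + ereal \<eta> \<longrightarrow>
           ereal (deriv \<phi> (real_of_ereal (f u - f x))) * edist_set 0 (limiting_subdiff f u) \<ge> 1))"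

definition accum :: "(nat \<Rightarrow> 'a::topological_space) \<Rightarrow> 'a set" where
  "accum u = {x. \<exists>r. strict_mono (r :: nat \<Rightarrow> nat) \<and> (u \<circ> r) \<longlonglongrightarrow> x}"

definition R_minimizing :: "('a \<Rightarrow> ereal) \<Rightarrow> ('a \<Rightarrow> 'b) \<Rightarrow> 'b \<Rightarrow> 'a \<Rightarrow> bool" where
  "R_minimizing R \<rho> z x \<longleftrightarrow> \<rho> x = z \<and> (\<forall>u. \<rho> u = z \<longrightarrow> R x \<le> R u)"

end

theory Submission
  imports Defs
begin

text \<open>
  The majorisation \<open>G p \<le> G y + \<nabla>G y \<bullet> (p - y) + L D\<^sub>h(p, y)\<close>, which is the gradient inequality for
  the convex function \<open>L h - G\<close>, and the strong convexity of \<open>h\<close> give the sufficient decrease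
  \<open>E(u\<^sub>k\<^sub>+\<^sub>1) + a d\<^sub>k\<^sup>2 \<le> E(u\<^sub>k)\<close> with \<open>d\<^sub>k = \<parallel>\<rho>(u\<^sub>k\<^sub>+\<^sub>1) - \<rho>(u\<^sub>k)\<parallel>\<close>. Near \<open>u\<^sub>k\<^sub>+\<^sub>1\<close> the objective and the
  surrogate differ by a \<open>C\<^sup>1\<close> function of \<open>\<rho>(u)\<close>, so stationarity for the surrogate yields a limiting
  subgradient of \<open>E\<close> of norm at most \<open>b d\<^sub>k\<close>. The Kurdyka--Lojasiewicz argument then shows that
  \<open>d\<close> is summable, so that \<open>\<rho>(u\<^sub>k)\<close> converges to some \<open>z\<close>. Comparing \<open>u\<^sub>k\<^sub>+\<^sub>1\<close> with any \<open>v\<close> in the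
  fibre \<open>\<rho> v = z\<close>, all terms of the surrogate other than \<open>R\<close> vanish in the limit, and lower
  semicontinuity of \<open>R\<close> finishes the proof.
\<close>

section \<open>Convex functions and gradients\<close>

text \<open>The strong convexity inequality along the segment from \<open>x\<close> to
  \<open>y\<close> is divided by \<open>t\<close>, and \<open>t\<close> tends to 0 from the right,
  where the difference quotient tends to \<open>d \<bullet> (y - x)\<close>.\<close>

lemma strongly_convex_on_gradient_ineq:
  assumes f: "strongly_convex_on S \<mu> f" and xy: "x \<in> S" "y \<in> S" and d: "GDERIV f x :> d"
  shows "f x + d \<bullet> (y - x) + \<mu> / 2 * (norm (y - x))\<^sup>2 \<le> f y"
proof -
  let ?g = "\<lambda>t::real. f (x + t *\<^sub>R (y - x))"
  have "(?g has_derivative (\<lambda>t. (t *\<^sub>R (y - x)) \<bullet> d)) (at 0)"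
  proof -
    have 1: "((\<lambda>t::real. x + t *\<^sub>R (y - x)) has_derivative (\<lambda>t. t *\<^sub>R (y - x))) (at 0)"
      by (auto intro!: derivative_eq_intros)
    have 2: "(f has_derivative (\<lambda>v. v \<bullet> d)) (at (x + 0 *\<^sub>R (y - x)))"
      using d by (simp add: gderiv_def)
    show ?thesis
      using has_derivative_compose[OF 1 2] .
  qed
  then have "(?g has_field_derivative d \<bullet> (y - x)) (at 0)"
    by (simp add: has_field_derivative_def inner_commute mult_commute_abs)
  then have "((\<lambda>t. (?g t - ?g 0) / t) \<longlongrightarrow> d \<bullet> (y - x)) (at 0)"
    by (simp add: has_field_derivative_iff)
  then have l: "((\<lambda>t. (?g t - ?g 0) / t) \<longlongrightarrow> d \<bullet> (y - x)) (at_right 0)"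
    by (rule filterlim_mono) (auto simp: at_le)
  have r: "((\<lambda>t. f y - f x - \<mu> / 2 * (1 - t) * (norm (y - x))\<^sup>2) \<longlongrightarrow>
      f y - f x - \<mu> / 2 * (1 - 0) * (norm (y - x))\<^sup>2) (at_right 0)"
    by (intro tendsto_intros)
  have "\<forall>\<^sub>F t in at_right 0. (?g t - ?g 0) / t \<le> f y - f x - \<mu> / 2 * (1 - t) * (norm (y - x))\<^sup>2"
    using eventually_at_right_real[of 0 1]
  proof (rule eventually_mono)
    show "(0::real) < 1" by simp
    fix t :: real assume t: "t \<in> {0<..<1}"
    have "(1 - t) *\<^sub>R x + t *\<^sub>R y = x + t *\<^sub>R (y - x)"
      by (simp add: algebra_simps)
    moreover have "f ((1 - t) *\<^sub>R x + t *\<^sub>R y)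
          \<le> (1 - t) * f x + t * f y - \<mu> / 2 * t * (1 - t) * (norm (y - x))\<^sup>2"
      using f xy t by (auto simp: strongly_convex_on_def norm_minus_commute)
    ultimately have "?g t - ?g 0 \<le> (f y - f x - \<mu> / 2 * (1 - t) * (norm (y - x))\<^sup>2) * t"
      by (simp add: algebra_simps)
    then show "(?g t - ?g 0) / t \<le> f y - f x - \<mu> / 2 * (1 - t) * (norm (y - x))\<^sup>2"
      using t by (simp add: divide_le_eq)
  qed
  from tendsto_le[OF _ r l this] show ?thesis
    by simp
qed

text \<open>Modulus zero lets the gradient inequality for convex functions be read off the strongly
  convex one.\<close>

lemma strongly_convex_on_0: "strongly_convex_on S 0 f \<longleftrightarrow> convex_on S f"
  unfolding strongly_convex_on_def
  by (auto simp: convex_on_imp_convex dest: convex_onD intro!: convex_onI)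

lemma convex_on_gradient_ineq:
  assumes "convex_on S f" "x \<in> S" "y \<in> S" "GDERIV f x :> d"
  shows "f x + d \<bullet> (y - x) \<le> f y"
  using strongly_convex_on_gradient_ineq[of S 0 f] assms by (simp add: strongly_convex_on_0)

section \<open>Gradients and finite values of extended-real functions\<close>

lemma GDERIV_unique:
  assumes "GDERIV f x :> d" "GDERIV f x :> e"
  shows "d = e"
proof -
  have "(\<lambda>v. v \<bullet> d) = (\<lambda>v. v \<bullet> e)"
    using assms unfolding gderiv_def by (rule has_derivative_unique)
  then show ?thesis
    by (metis inner_commute vector_eq_rdot)
qed

lemma differentiable_imp_GDERIV:
  fixes f :: "'a::euclidean_space \<Rightarrow> real"
  assumes "f differentiable (at x)"
  shows "\<exists>d. GDERIV f x :> d"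
proof -
  from assms obtain f' where f': "(f has_derivative f') (at x)"
    unfolding differentiable_def by auto
  then have "linear f'"
    by (rule has_derivative_linear)
  then have "f' = (\<lambda>v. v \<bullet> adjoint f' 1)"
    by (simp add: adjoint_works)
  with f' show ?thesis
    unfolding gderiv_def by metis
qed

lemma egrad_eq: "GDERIV (\<lambda>y. real_of_ereal (f y)) x :> d \<Longrightarrow> egrad f x = d"
  unfolding egrad_def by (rule the_equality) (auto intro: GDERIV_unique)

lemma ediff_GDERIV:
  fixes f :: "'a::euclidean_space \<Rightarrow> ereal"
  assumes "ediff f x"
  shows "GDERIV (\<lambda>y. real_of_ereal (f y)) x :> egrad f x"
  using differentiable_imp_GDERIV[OF assms[unfolded ediff_def]] egrad_eq by metis

lemma proper_ereal: "proper f \<Longrightarrow> x \<in> edom f \<Longrightarrow> ereal (real_of_ereal (f x)) = f x"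
  by (cases "f x") (auto simp: proper_def edom_def)

lemma proper_finite: "proper f \<Longrightarrow> x \<in> edom f \<Longrightarrow> \<exists>r. f x = ereal r"
  by (metis proper_ereal)

lemma econvex_convex_edom:
  assumes "econvex f"
  shows "convex (edom f)"
  unfolding convex_alt
proof (intro ballI allI impI)
  fix x y and t :: real
  assume "x \<in> edom f" "y \<in> edom f" "0 \<le> t \<and> t \<le> 1"
  then have "ereal (1 - t) * f x + ereal t * f y < \<infinity>"
    by (cases "f x"; cases "f y") (auto simp: edom_def)
  moreover have "f ((1 - t) *\<^sub>R x + t *\<^sub>R y) \<le> ereal (1 - t) * f x + ereal t * f y"
    using assms \<open>0 \<le> t \<and> t \<le> 1\<close> by (auto simp: econvex_def)
  ultimately show "(1 - t) *\<^sub>R x + t *\<^sub>R y \<in> edom f"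
    by (auto simp: edom_def)
qed

lemma econvex_convex_on:
  assumes "proper f" "econvex f"
  shows "convex_on (edom f) (\<lambda>x. real_of_ereal (f x))"
proof (rule convex_onI)
  show conv: "convex (edom f)"
    using assms(2) by (rule econvex_convex_edom)
  fix t :: real and x y
  assume t: "0 < t" "t < 1" and xy: "x \<in> edom f" "y \<in> edom f"
  have "(1 - t) *\<^sub>R x + t *\<^sub>R y \<in> edom f"
    using conv t xy by (simp add: convex_alt)
  moreover have "f ((1 - t) *\<^sub>R x + t *\<^sub>R y) \<le> ereal (1 - t) * f x + ereal t * f y"
    using assms t by (auto simp: econvex_def)
  ultimately show "real_of_ereal (f ((1 - t) *\<^sub>R x + t *\<^sub>R y))
      \<le> (1 - t) * real_of_ereal (f x) + t * real_of_ereal (f y)"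
    using proper_finite[OF assms(1) xy(1)] proper_finite[OF assms(1) xy(2)]
      proper_finite[OF assms(1), of "(1 - t) *\<^sub>R x + t *\<^sub>R y"]
    by auto
qed

text \<open>A hyperplane separates \<open>(x, f x)\<close> from the strict epigraph. Since
  \<open>x\<close> is interior the hyperplane is not vertical, and its slope is a
  subgradient.\<close>

lemma convex_on_subgradient_exists:
  fixes f :: "'a::euclidean_space \<Rightarrow> real"
  assumes f: "convex_on D f" and x: "x \<in> interior D"
  shows "\<exists>v. \<forall>y\<in>D. f x + v \<bullet> (y - x) \<le> f y"
proof -
  have xD: "x \<in> D" using x interior_subset by auto
  let ?T = "(\<lambda>p. p - (x, f x)) ` {p. fst p \<in> D \<and> f (fst p) < snd p}"
  have conv: "convex {p. fst p \<in> D \<and> f (fst p) < snd p}"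
    unfolding convex_alt
  proof (intro ballI allI impI)
    fix p q and t :: real
    assume p: "p \<in> {p. fst p \<in> D \<and> f (fst p) < snd p}" and q: "q \<in> {p. fst p \<in> D \<and> f (fst p) < snd p}"
      and t: "0 \<le> t \<and> t \<le> 1"
    have "f ((1 - t) *\<^sub>R fst p + t *\<^sub>R fst q) \<le> (1 - t) * f (fst p) + t * f (fst q)"
      using f p q t by (auto dest: convex_onD)
    also have "\<dots> < (1 - t) * snd p + t * snd q"
    proof (cases "t = 0")
      case False
      then show ?thesis
        using p q t by (intro add_le_less_mono mult_left_mono mult_strict_left_mono) auto
    qed (use p in auto)
    finally show "(1 - t) *\<^sub>R p + t *\<^sub>R q \<in> {p. fst p \<in> D \<and> f (fst p) < snd p}"
      using convex_on_imp_convex[OF f] p q t by (auto simp: convex_alt)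
  qed
  have "convex ?T"
    using convex_translation_subtract[OF conv] .
  moreover have "0 \<notin> ?T"
    by (auto simp: zero_prod_def)
  ultimately obtain c where c: "c \<noteq> 0" "\<forall>p\<in>?T. 0 \<le> c \<bullet> p"
    using separating_hyperplane_set_0 by blast
  obtain a b where ab: "c = (a, b)" by fastforce
  have sep: "0 \<le> a \<bullet> (y - x) + b * (t - f x)" if "y \<in> D" "f y < t" for y t
  proof -
    have "(y, t) - (x, f x) \<in> ?T" using that by (intro imageI) simp
    then have "0 \<le> c \<bullet> ((y, t) - (x, f x))" using c(2) by blast
    then show ?thesis by (simp add: ab inner_prod_def)
  qed
  have b0: "0 \<le> b"
    using sep[OF xD, of "f x + 1"] by simp
  have "b \<noteq> 0"
  proof
    assume b: "b = 0"
    with c ab have a: "a \<noteq> 0" by (simp add: zero_prod_def)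
    from x obtain e where e: "e > 0" "cball x e \<subseteq> D"
      unfolding mem_interior_cball by auto
    \<comment> \<open>This point of the ball lies at distance \<open>e\<close> from \<open>x\<close>
      against the direction \<open>a\<close>, so a vertical hyperplane would have it on the wrong
      side.\<close>
    let ?y = "x - (e / norm a) *\<^sub>R a"
    have "?y \<in> cball x e" using e a by (simp add: dist_norm)
    then have "0 \<le> a \<bullet> (?y - x) + b * (f ?y + 1 - f x)"
      using e by (intro sep) auto
    then have "0 \<le> - (e / norm a * (a \<bullet> a))"
      by (simp add: b)
    moreover have "0 < e / norm a * (a \<bullet> a)"
      using e a by (intro mult_pos_pos) auto
    ultimately show False by simp
  qed
  with b0 have bp: "0 < b" by simp
  \<comment> \<open>Dividing by \<open>b\<close> turns the normal \<open>(a, b)\<close> into the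
    slope \<open>- a / b\<close>. The slack \<open>e\<close> appears because only points strictly
    above the graph are separated.\<close>
  have "f x + (- (1 / b) *\<^sub>R a) \<bullet> (y - x) \<le> f y" if y: "y \<in> D" for y
  proof (rule field_le_epsilon)
    fix e :: real assume e: "0 < e"
    have "0 \<le> a \<bullet> (y - x) + b * (f y + e - f x)"
      using sep[OF y] e by simp
    then have "0 \<le> (a \<bullet> (y - x) + b * (f y + e - f x)) / b"
      using bp by simp
    also have "\<dots> = (1 / b) * (a \<bullet> (y - x)) + (f y + e - f x)"
      using bp by (simp add: field_simps)
    finally show "f x + (- (1 / b) *\<^sub>R a) \<bullet> (y - x) \<le> f y + e"
      by simp
  qed
  then show ?thesis by blast
qed

lemma convex_subdiff_iff:
  assumes "proper f" "x \<in> edom f"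
  shows "v \<in> convex_subdiff f x \<longleftrightarrow>
    (\<forall>y\<in>edom f. real_of_ereal (f x) + v \<bullet> (y - x) \<le> real_of_ereal (f y))"
proof -
  have "f x + ereal (v \<bullet> (y - x)) \<le> f y \<longleftrightarrow>
     (y \<in> edom f \<longrightarrow> real_of_ereal (f x) + v \<bullet> (y - x) \<le> real_of_ereal (f y))" for y
    using assms by (cases "f x"; cases "f y") (auto simp: proper_def edom_def)
  then show ?thesis
    using assms(2) by (auto simp: convex_subdiff_def)
qed

text \<open>Subgradients at points \<open>y\<close> near \<open>x\<close> are bounded and accumulate only at subgradients at
  \<open>x\<close>, so uniqueness makes them converge, and the first-order error of \<open>h\<close> at \<open>x\<close> is at most
  \<open>(v\<^sub>y - v\<^sub>x) \<bullet> (y - x)\<close>.\<close>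

lemma essentially_smooth_GDERIV:
  fixes h :: "'a::euclidean_space \<Rightarrow> ereal"
  assumes h: "proper h" "econvex h" "essentially_smooth h" and x: "x \<in> interior (edom h)"
  shows "GDERIV (\<lambda>y. real_of_ereal (h y)) x :> egrad h x" "egrad h x \<in> convex_subdiff h x"
proof -
  let ?h = "\<lambda>y. real_of_ereal (h y)" and ?S = "interior (edom h)"
  have conv: "convex_on (edom h) ?h"
    using h by (intro econvex_convex_on)
  have dom: "y \<in> edom h" if "y \<in> ?S" for y
    using that interior_subset by blast
  have "\<exists>v. v \<in> convex_subdiff h y" if y: "y \<in> ?S" for y
    using convex_on_subgradient_exists[OF conv y] convex_subdiff_iff[OF h(1) dom[OF y]] by auto
  then obtain v where v: "\<And>y. y \<in> ?S \<Longrightarrow> v y \<in> convex_subdiff h y"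
    by metis
  have v_le: "?h y + v y \<bullet> (w - y) \<le> ?h w" if "y \<in> ?S" "w \<in> ?S" for y w
    using v[OF that(1)] convex_subdiff_iff[OF h(1) dom[OF that(1)]] dom[OF that(2)] by blast
  obtain e where e: "e > 0" "bounded (\<Union>y\<in>ball x e. convex_subdiff h y)"
    and un: "\<And>w. w \<in> convex_subdiff h x \<Longrightarrow> w = v x"
    using h(3) v[OF x] x unfolding essentially_smooth_def by blast
  have cont: "continuous_on (edom h \<inter> ?S) ?h"
    using convex_on_continuous[of ?S ?h] convex_on_subset[OF conv interior_subset]
      convex_interior[OF convex_on_imp_convex[OF conv]]
    by (simp add: Int_absorb1 interior_subset)
  have cont: "isCont ?h y" if "y \<in> ?S" for y
    using cont that by (simp add: Int_absorb1 interior_subset continuous_on_eq_continuous_at)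
  have vx: "v \<midarrow>x\<rightarrow> v x"
  proof (rule ccontr)
    assume "\<not> v \<midarrow>x\<rightarrow> v x"
    \<comment> \<open>A violating sequence is thinned twice: \<open>r\<close> keeps the subgradients
      at distance at least \<open>\<epsilon>\<close> from \<open>v x\<close> and the points near
      \<open>x\<close>, then \<open>q\<close> makes the subgradients converge.\<close>
    then obtain s where s: "\<forall>n. s n \<noteq> x" "s \<longlonglongrightarrow> x" "\<not> (\<lambda>n. v (s n)) \<longlonglongrightarrow> v x"
      unfolding tendsto_at_iff_sequentially by (auto simp: o_def)
    then obtain \<epsilon> where \<epsilon>: "\<epsilon> > 0" "\<exists>\<^sub>F n in sequentially. \<not> dist (v (s n)) (v x) < \<epsilon>"
      unfolding tendsto_iff frequently_def by auto
    have "open (?S \<inter> ball x e)" "x \<in> ?S \<inter> ball x e"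
      using x e by auto
    then have "\<forall>\<^sub>F n in sequentially. s n \<in> ?S \<inter> ball x e"
      using s(2) by (metis topological_tendstoD)
    then have "\<forall>\<^sub>F n in sequentially. \<not> dist (v (s n)) (v x) < \<epsilon> \<longrightarrow>
        \<not> dist (v (s n)) (v x) < \<epsilon> \<and> s n \<in> ?S \<inter> ball x e"
      by (rule eventually_mono) blast
    with \<epsilon>(2) have "\<exists>\<^sub>F n in sequentially. \<not> dist (v (s n)) (v x) < \<epsilon> \<and> s n \<in> ?S \<inter> ball x e"
      by (rule frequently_rev_mp)
    then have "infinite {n. \<not> dist (v (s n)) (v x) < \<epsilon> \<and> s n \<in> ?S \<inter> ball x e}"
      by (simp add: frequently_cofinite flip: cofinite_eq_sequentially)
    then obtain r :: "nat \<Rightarrow> nat" where r: "strict_mono r"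
      "\<And>n. \<not> dist (v (s (r n))) (v x) < \<epsilon> \<and> s (r n) \<in> ?S \<inter> ball x e"
      by (metis (no_types, lifting) infinite_enumerate mem_Collect_eq)
    have "range (\<lambda>n. v (s (r n))) \<subseteq> (\<Union>y\<in>ball x e. convex_subdiff h y)"
      using r(2) v by blast
    then have "bounded (range (\<lambda>n. v (s (r n))))"
      using e(2) bounded_subset by blast
    then obtain l q where q: "strict_mono (q :: nat \<Rightarrow> nat)" "((\<lambda>n. v (s (r n))) \<circ> q) \<longlonglongrightarrow> l"
      using bounded_imp_convergent_subsequence by blast
    let ?s = "\<lambda>n. s (r (q n))"
    have sx: "?s \<longlonglongrightarrow> x"
      using LIMSEQ_subseq_LIMSEQ[OF LIMSEQ_subseq_LIMSEQ[OF s(2) r(1)] q(1)] by (simp add: o_def)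
    have vl: "(\<lambda>n. v (?s n)) \<longlonglongrightarrow> l"
      using q(2) by (simp add: o_def)
    have "?h x + l \<bullet> (y - x) \<le> ?h y" if y: "y \<in> edom h" for y
    proof (rule LIMSEQ_le_const2)
      show "(\<lambda>n. ?h (?s n) + v (?s n) \<bullet> (y - ?s n)) \<longlonglongrightarrow> ?h x + l \<bullet> (y - x)"
        by (intro tendsto_add tendsto_inner tendsto_diff tendsto_const vl sx
            isCont_tendsto_compose[OF cont[OF x]])
      have "?h (?s n) + v (?s n) \<bullet> (y - ?s n) \<le> ?h y" for n
        using v[of "?s n"] r(2)[of "q n"] y convex_subdiff_iff[OF h(1) dom, of "?s n"] by blast
      then show "\<exists>N. \<forall>n\<ge>N. ?h (?s n) + v (?s n) \<bullet> (y - ?s n) \<le> ?h y"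
        by blast
    qed
    then have "l = v x"
      using convex_subdiff_iff[OF h(1) dom[OF x]] un by blast
    with vl have "(\<lambda>n. v (?s n)) \<longlonglongrightarrow> v x" by simp
    then have "\<forall>\<^sub>F n in sequentially. dist (v (?s n)) (v x) < \<epsilon>"
      using \<epsilon>(1) by (rule tendstoD)
    then show False
      using r(2) by (auto simp: eventually_sequentially)
  qed
  have "GDERIV ?h x :> v x"
    unfolding gderiv_def has_derivative_at2
  proof
    show "bounded_linear (\<lambda>w. w \<bullet> v x)"
      by (rule bounded_linear_inner_left)
    have "((\<lambda>y. norm (v y - v x)) \<longlongrightarrow> 0) (at x)"
      using vx by (metis LIM_zero tendsto_norm_zero)
    moreover have "\<forall>\<^sub>F y in at x. norm (inverse (norm (y - x)) *\<^sub>R (?h y - (?h x + (y - x) \<bullet> v x))) \<le> norm (v y - v x)"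
    proof -
      have "\<forall>\<^sub>F y in at x. y \<in> ?S"
        using x by (intro eventually_at_in_open') auto
      then show ?thesis
      proof (rule eventually_mono)
        fix y assume y: "y \<in> ?S"
        have 1: "0 \<le> ?h y - (?h x + (y - x) \<bullet> v x)"
          using v_le[OF x y] by (simp add: inner_commute)
        have "?h y - (?h x + (y - x) \<bullet> v x) \<le> (v y - v x) \<bullet> (y - x)"
          using v_le[OF y x] by (simp add: algebra_simps inner_commute)
        also have "\<dots> \<le> norm (v y - v x) * norm (y - x)"
          by (rule norm_cauchy_schwarz)
        finally show "norm (inverse (norm (y - x)) *\<^sub>R (?h y - (?h x + (y - x) \<bullet> v x))) \<le> norm (v y - v x)"
          using 1 by (cases "y = x") (auto simp: field_simps)
      qed
    qed
    ultimately show "(\<lambda>y. (1 / norm (y - x)) *\<^sub>R (?h y - (?h x + (y - x) \<bullet> v x))) \<midarrow>x\<rightarrow> 0"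
      unfolding inverse_eq_divide by (rule Lim_null_comparison[rotated])
  qed
  then show "GDERIV ?h x :> egrad h x" "egrad h x \<in> convex_subdiff h x"
    using egrad_eq[of h] v[OF x] by simp_all
qed

section \<open>The Kurdyka--Lojasiewicz argument\<close>

text \<open>A form without subsequences, which makes closedness of \<open>accum u\<close> a matter
  of halving \<open>e\<close>. For the converse, indices are chosen recursively, increasing and with
  tolerance \<open>1 / (n + 1)\<close>.\<close>

lemma accum_iff_frequently:
  fixes u :: "nat \<Rightarrow> 'a::metric_space"
  shows "x \<in> accum u \<longleftrightarrow> (\<forall>e>0. \<exists>\<^sub>F k in sequentially. dist (u k) x < e)"
proof
  assume "x \<in> accum u"
  then obtain r where r: "strict_mono (r :: nat \<Rightarrow> nat)" "(u \<circ> r) \<longlonglongrightarrow> x"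
    by (auto simp: accum_def)
  show "\<forall>e>0. \<exists>\<^sub>F k in sequentially. dist (u k) x < e"
    unfolding frequently_sequentially
  proof (intro allI impI)
    fix e :: real and N assume "0 < e"
    with r(2) have "\<forall>\<^sub>F n in sequentially. dist (u (r n)) x < e"
      by (auto simp: tendsto_iff o_def)
    then have "\<forall>\<^sub>F n in sequentially. dist (u (r n)) x < e \<and> n \<ge> N"
      by (intro eventually_conj eventually_ge_at_top)
    then obtain n where "dist (u (r n)) x < e" "n \<ge> N"
      using eventually_happens'[OF sequentially_bot] by blast
    moreover have "r n \<ge> N"
      using seq_suble[OF r(1), of n] \<open>n \<ge> N\<close> by linarith
    ultimately show "\<exists>n\<ge>N. dist (u n) x < e"
      by blast
  qed
next
  assume freq: "\<forall>e>0. \<exists>\<^sub>F k in sequentially. dist (u k) x < e"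
  have "\<exists>r :: nat \<Rightarrow> nat. \<forall>n. dist (u (r n)) x < inverse (real (Suc n)) \<and> r n < r (Suc n)"
  proof (rule dependent_nat_choice)
    have "\<exists>\<^sub>F k in sequentially. dist (u k) x < inverse (real (Suc 0))"
      using freq by simp
    then show "\<exists>k. dist (u k) x < inverse (real (Suc 0))"
      by (rule frequently_ex)
    fix k n
    have "\<exists>\<^sub>F k in sequentially. dist (u k) x < inverse (real (Suc (Suc n)))"
      using freq by simp
    then obtain l where "l \<ge> Suc k" "dist (u l) x < inverse (real (Suc (Suc n)))"
      unfolding frequently_sequentially by blast
    then show "\<exists>l. dist (u l) x < inverse (real (Suc (Suc n))) \<and> k < l"
      by (intro exI[of _ l]) auto
  qed
  then obtain r :: "nat \<Rightarrow> nat"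
    where r: "\<And>n. dist (u (r n)) x < inverse (real (Suc n))" "\<And>n. r n < r (Suc n)"
    by blast
  have "(\<lambda>n. dist (u (r n)) x) \<longlonglongrightarrow> 0"
    by (rule tendsto_sandwich[OF always_eventually always_eventually tendsto_const
          LIMSEQ_inverse_real_of_nat]) (intro allI zero_le_dist less_imp_le[OF r(1)])+
  then have "(u \<circ> r) \<longlonglongrightarrow> x"
    unfolding o_def by (rule tendsto_dist_iff[THEN iffD2])
  then show "x \<in> accum u"
    using r(2) by (auto simp: accum_def strict_mono_Suc_iff)
qed

lemma closed_accum: "closed (accum u)" for u :: "nat \<Rightarrow> 'a::metric_space"
  unfolding closure_subset_eq[symmetric]
proof
  fix x assume "x \<in> closure (accum u)"
  then have x: "\<forall>e>0. \<exists>y\<in>accum u. dist y x < e"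
    by (simp add: closure_approachable)
  show "x \<in> accum u"
    unfolding accum_iff_frequently
  proof (intro allI impI)
    fix e :: real assume "e > 0"
    then obtain y where y: "y \<in> accum u" "dist y x < e / 2"
      using x half_gt_zero by blast
    then have "\<exists>\<^sub>F k in sequentially. dist (u k) y < e / 2"
      using half_gt_zero[OF \<open>e > 0\<close>] unfolding accum_iff_frequently by blast
    then show "\<exists>\<^sub>F k in sequentially. dist (u k) x < e"
      by (rule frequently_elim1) (metis y(2) dist_commute dist_triangle_half_r)
  qed
qed

lemma accum_subset_closure: "accum u \<subseteq> closure (range u)" for u :: "nat \<Rightarrow> 'a::metric_space"
proof
  fix x assume "x \<in> accum u"
  then obtain r where "(u \<circ> r) \<longlonglongrightarrow> x"
    by (auto simp: accum_def)
  then show "x \<in> closure (range u)"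
    unfolding closure_sequential by (intro exI[of _ "u \<circ> r"]) auto
qed

lemma compact_accum:
  fixes u :: "nat \<Rightarrow> 'a::heine_borel"
  assumes "bounded (range u)"
  shows "compact (accum u)"
  using assms accum_subset_closure[of u] closed_accum[of u]
  by (meson bounded_closure bounded_subset compact_eq_bounded_closed)

lemma accum_subseq:
  assumes "strict_mono (r :: nat \<Rightarrow> nat)"
  shows "accum (u \<circ> r) \<subseteq> accum u"
  using assms unfolding accum_def by (auto simp: o_assoc[symmetric] intro: strict_mono_o)

lemma accum_nonempty:
  fixes u :: "nat \<Rightarrow> 'a::heine_borel"
  assumes "bounded (range u)"
  shows "accum u \<noteq> {}"
  using bounded_imp_convergent_subsequence[OF assms] by (auto simp: accum_def)

text \<open>Otherwise a bounded subsequence stays in the closed complement of \<open>U\<close>, and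
  it has an accumulation point there.\<close>

lemma eventually_mem_open_if_accum_subset:
  fixes u :: "nat \<Rightarrow> 'a::heine_borel"
  assumes bdd: "bounded (range u)" and U: "open U" "accum u \<subseteq> U"
  shows "\<forall>\<^sub>F k in sequentially. u k \<in> U"
proof (rule ccontr)
  assume "\<not> (\<forall>\<^sub>F k in sequentially. u k \<in> U)"
  then have "infinite {k. u k \<notin> U}"
    by (simp add: not_eventually frequently_cofinite flip: cofinite_eq_sequentially)
  then obtain r :: "nat \<Rightarrow> nat" where r: "strict_mono r" "\<And>n. u (r n) \<notin> U"
    by (metis (no_types, lifting) infinite_enumerate mem_Collect_eq)
  have "bounded (range (u \<circ> r))"
    using bdd by (rule bounded_subset) auto
  then obtain x where x: "x \<in> accum (u \<circ> r)"
    using accum_nonempty by blast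
  have "accum (u \<circ> r) \<subseteq> - U"
    using accum_subset_closure[of "u \<circ> r"] closure_minimal[of "range (u \<circ> r)" "- U"] r(2) U(1)
    by (auto simp: closed_Compl)
  then show False
    using x U(2) accum_subseq[OF r(1), of u] by blast
qed

section \<open>From the desingularising functions to summable steps\<close>

text \<open>One copy of \<open>d (Suc k)\<close> goes into the partial sum, the other pays for the
  \<open>d\<close> on the right of the next inequality, and \<open>P\<close> telescopes. The
  induction carries the leftover \<open>d\<close> and \<open>P\<close> along with the sum.\<close>

lemma summable_if_double_le_telescoping:
  fixes d P :: "nat \<Rightarrow> real"
  assumes d: "\<And>k. 0 \<le> d k" and P: "\<And>k. k \<ge> N \<Longrightarrow> 0 \<le> P k"
    and le: "\<And>k. k \<ge> N \<Longrightarrow> 2 * d (Suc k) \<le> P k - P (Suc k) + d k"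
  shows "summable d"
proof -
  have "(\<Sum>i<n. d (i + Suc N)) + d (N + n) + P (N + n) \<le> d N + P N" for n
  proof (induction n)
    case (Suc n)
    then show ?case
      using le[of "N + n"] by (simp add: add.commute)
  qed simp
  then have "(\<Sum>i<n. d (i + Suc N)) \<le> d N + P N" for n
    using d[of "N + n"] P[of "N + n"] by (smt (verit) le_add1)
  then have "summable (\<lambda>i. d (i + Suc N))"
    using d by (intro summableI_nonneg_bounded)
  then show ?thesis
    by (simp only: summable_iff_shift)
qed

lemma concave_on_tangent_ineq:
  fixes \<phi> :: "real \<Rightarrow> real"
  assumes "concave_on S \<phi>" "s \<in> S" "t \<in> S" "(\<phi> has_field_derivative D) (at s)"
  shows "D * (s - t) \<le> \<phi> s - \<phi> t"
  using convex_on_gradient_ineq[of S "\<lambda>x. - \<phi> x" s t "- D"] assms(1-3) DERIV_minus[OF assms(4)]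
  by (simp add: concave_on_def right_diff_distrib)

text \<open>Concavity and differentiability of \<open>\<phi>\<close> enter the argument only through
  the tangent inequality, which includes \<open>t = 0\<close>, the level of \<open>x\<close>
  itself.\<close>

lemma KL_propertyE:
  assumes "KL_property f x" "f x = ereal c"
  obtains \<eta> \<phi> \<phi>' U where "\<eta> > 0" "open U" "x \<in> U" "\<phi> 0 = (0::real)"
    "\<And>s. 0 < s \<Longrightarrow> s < \<eta> \<Longrightarrow> \<phi>' s > 0"
    "\<And>s t. 0 < s \<Longrightarrow> s < \<eta> \<Longrightarrow> 0 \<le> t \<Longrightarrow> t < \<eta> \<Longrightarrow> \<phi>' s * (s - t) \<le> \<phi> s - \<phi> t"
    "\<And>w r. w \<in> U \<Longrightarrow> f w = ereal r \<Longrightarrow> c < r \<Longrightarrow> r < c + \<eta> \<Longrightarrow>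
      1 \<le> ereal (\<phi>' (r - c)) * edist_set 0 (limiting_subdiff f w)"
proof -
  from assms obtain \<eta> \<phi> U where \<eta>: "\<eta> > 0" and C1: "\<phi> C1_differentiable_on {0<..<\<eta>}"
    and \<phi>: "\<phi> 0 = (0::real)" "concave_on {0..<\<eta>} \<phi>" "\<forall>s\<in>{0<..<\<eta>}. deriv \<phi> s > 0"
    and U: "open U" "x \<in> U"
    and KL: "\<forall>u\<in>U. f x < f u \<and> f u < f x + ereal \<eta> \<longrightarrow>
       ereal (deriv \<phi> (real_of_ereal (f u - f x))) * edist_set 0 (limiting_subdiff f u) \<ge> 1"
    unfolding KL_property_def by auto
  have "(\<phi> has_field_derivative deriv \<phi> s) (at s)" if "0 < s" "s < \<eta>" for s
    using C1 that unfolding C1_differentiable_on_eq DERIV_deriv_iff_real_differentiable by auto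
  note D = this
  show thesis
  proof (rule that[of \<eta> U \<phi> "deriv \<phi>"])
    show "deriv \<phi> s * (s - t) \<le> \<phi> s - \<phi> t" if "0 < s" "s < \<eta>" "0 \<le> t" "t < \<eta>" for s t
      using that D by (intro concave_on_tangent_ineq[OF \<phi>(2)]) auto
    show "1 \<le> ereal (deriv \<phi> (r - c)) * edist_set 0 (limiting_subdiff f w)"
      if "w \<in> U" "f w = ereal r" "c < r" "r < c + \<eta>" for w r
      using bspec[OF KL that(1)] that assms(2) by simp
  qed (use \<eta> \<phi> U in auto)
qed

text \<open>Since the iterates themselves need not converge, the Kurdyka--Lojasiewicz inequality is
  uniformised over a finite cover of the accumulation points, with the sum of the finitely many
  desingularising functions in the role of a single one.\<close>

lemma KL_summable_steps:
  fixes f :: "'a::euclidean_space \<Rightarrow> ereal" and e d :: "nat \<Rightarrow> real"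
  assumes bdd: "bounded (range u)" and below: "bounded_from_below f"
    and f: "\<And>k. f (u k) = ereal (e k)"
    and cont: "continuous_on (edom f) f" and KL: "\<forall>x\<in>accum u. KL_property f x"
    and a: "0 < a" and d: "\<And>k. 0 \<le> d k" and dec: "\<And>k. e (Suc k) + a * (d k)\<^sup>2 \<le> e k"
    and dist: "\<And>k. k \<ge> N0 \<Longrightarrow> edist_set 0 (limiting_subdiff f (u (Suc k))) \<le> ereal (b * d k)"
    and b: "0 \<le> b"
  shows "summable d"
proof -
  have dec': "e (Suc k) \<le> e k" for k
    using dec[of k] a by (smt (verit) mult_nonneg_nonneg zero_le_power2)
  then have decs: "decseq e"
    by (simp add: decseq_Suc_iff)
  obtain c where c: "\<And>x. ereal c \<le> f x"
    using below by (auto simp: bounded_from_below_def)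
  have "c \<le> e k" for k
    using c[of "u k"] f by simp
  with decs obtain es where es: "e \<longlonglongrightarrow> es" "\<And>k. es \<le> e k"
    using decseq_convergent[of e c] by blast
  \<comment> \<open>The energies decrease to \<open>es\<close> and \<open>f\<close> is continuous on
    its domain, so the KL inequalities at all accumulation points refer to one common level.\<close>
  have f_accum: "f x = ereal es" if x: "x \<in> accum u" for x
  proof -
    obtain r where r: "strict_mono (r :: nat \<Rightarrow> nat)" "(u \<circ> r) \<longlonglongrightarrow> x"
      using x by (auto simp: accum_def)
    have "x \<in> edom f" using KL x by (auto simp: KL_property_def)
    moreover have "\<forall>n. (u \<circ> r) n \<in> edom f" using f by (simp add: edom_def)
    ultimately have "(\<lambda>n. f (u (r n))) \<longlonglongrightarrow> f x"
      using cont r(2) unfolding continuous_on_sequentially by (auto simp: o_def)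
    moreover have "(\<lambda>n. f (u (r n))) \<longlonglongrightarrow> ereal es"
      using LIMSEQ_subseq_LIMSEQ[OF es(1) r(1)] f by (simp add: o_def)
    ultimately show ?thesis
      by (rule LIMSEQ_unique)
  qed
  \<comment> \<open>\<open>Q\<close> bundles the KL data so that the four objects can be chosen
    simultaneously as functions of the accumulation point.\<close>
  define Q where "Q x \<eta> \<phi> \<phi>' U \<longleftrightarrow> \<eta> > 0 \<and> open U \<and> x \<in> U \<and> \<phi> 0 = (0::real) \<and>
    (\<forall>s. 0 < s \<longrightarrow> s < \<eta> \<longrightarrow> \<phi>' s > 0) \<and>
    (\<forall>s t. 0 < s \<longrightarrow> s < \<eta> \<longrightarrow> 0 \<le> t \<longrightarrow> t < \<eta> \<longrightarrow> \<phi>' s * (s - t) \<le> \<phi> s - \<phi> t) \<and>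
    (\<forall>w r. w \<in> U \<longrightarrow> f w = ereal r \<longrightarrow> es < r \<longrightarrow> r < es + \<eta> \<longrightarrow>
      1 \<le> ereal (\<phi>' (r - es)) * edist_set 0 (limiting_subdiff f w))" for x \<eta> \<phi> \<phi>' U
  have "\<exists>\<eta> \<phi> \<phi>' U. Q x \<eta> \<phi> \<phi>' U" if x: "x \<in> accum u" for x
    by (rule KL_propertyE[OF bspec[OF KL x] f_accum[OF x]]) (unfold Q_def, blast)
  then obtain \<eta> \<phi> \<phi>' U where Q: "\<And>x. x \<in> accum u \<Longrightarrow> Q x (\<eta> x) (\<phi> x) (\<phi>' x) (U x)"
    by metis
  note KL' = Q[unfolded Q_def]
  obtain F where F: "F \<subseteq> accum u" "finite F" "accum u \<subseteq> (\<Union>x\<in>F. U x)"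
    by (rule compactE_image[OF compact_accum[OF bdd], of "accum u" U]) (use KL' in auto)
  have KLF: "\<eta> x > 0" "open (U x)" "\<phi> x 0 = 0"
    "\<And>s. 0 < s \<Longrightarrow> s < \<eta> x \<Longrightarrow> \<phi>' x s > 0"
    "\<And>s t. 0 < s \<Longrightarrow> s < \<eta> x \<Longrightarrow> 0 \<le> t \<Longrightarrow> t < \<eta> x \<Longrightarrow> \<phi>' x s * (s - t) \<le> \<phi> x s - \<phi> x t"
    "\<And>w r. w \<in> U x \<Longrightarrow> f w = ereal r \<Longrightarrow> es < r \<Longrightarrow> r < es + \<eta> x \<Longrightarrow>
      1 \<le> ereal (\<phi>' x (r - es)) * edist_set 0 (limiting_subdiff f w)"
    if "x \<in> F" for x
    using KL'[of x] that F(1) by blast+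
  have "\<forall>\<^sub>F k in sequentially. u k \<in> (\<Union>x\<in>F. U x)"
    using KLF(2) F(3) by (intro eventually_mem_open_if_accum_subset bdd) auto
  moreover have "\<forall>\<^sub>F k in sequentially. \<forall>x\<in>F. e k < es + \<eta> x"
    using F(2) KLF(1) by (intro eventually_ball_finite ballI order_tendstoD(2)[OF es(1)]) auto
  ultimately have "\<forall>\<^sub>F k in sequentially. u k \<in> (\<Union>x\<in>F. U x) \<and> (\<forall>x\<in>F. e k < es + \<eta> x) \<and> k \<ge> N0"
    by (intro eventually_conj eventually_ge_at_top)
  then obtain N where N: "\<And>k. k \<ge> N \<Longrightarrow> u k \<in> (\<Union>x\<in>F. U x)"
      "\<And>k x. k \<ge> N \<Longrightarrow> x \<in> F \<Longrightarrow> e k < es + \<eta> x" "N \<ge> N0"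
    unfolding eventually_sequentially by blast
  define \<Phi> where "\<Phi> k = (\<Sum>x\<in>F. \<phi> x (e k - es))" for k
  have mono: "\<phi> x s \<ge> \<phi> x t" if "x \<in> F" "0 \<le> t" "t \<le> s" "s < \<eta> x" for x s t
  proof (cases "s = t")
    case False
    with that have "0 < s" by simp
    with that have "0 \<le> \<phi>' x s * (s - t)"
      using KLF(4)[of x s] by (intro mult_nonneg_nonneg) auto
    then show ?thesis
      using KLF(5)[of x s t] that \<open>0 < s\<close> by auto
  qed simp
  have \<Phi>_nonneg: "0 \<le> \<Phi> k" if "k \<ge> N" for k
    unfolding \<Phi>_def
  proof (rule sum_nonneg)
    fix x assume x: "x \<in> F"
    show "0 \<le> \<phi> x (e k - es)"
      using mono[of x 0 "e k - es"] x es(2)[of k] N(2)[OF that x] KLF(3)[OF x] by auto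
  qed
  have step: "2 * d (Suc k) \<le> b / a * \<Phi> (Suc k) - b / a * \<Phi> (Suc (Suc k)) + d k" if k: "k \<ge> N" for k
  proof -
    define s t where "s = e (Suc k) - es" and "t = e (Suc (Suc k)) - es"
    have st: "0 \<le> t" "t \<le> s" "a * (d (Suc k))\<^sup>2 \<le> s - t"
      using es(2) dec' dec[of "Suc k"] by (auto simp: s_def t_def)
    have s\<eta>: "s < \<eta> x" if "x \<in> F" for x
      using N(2)[of "Suc k" x] that k by (simp add: s_def)
    have le: "\<phi> x t \<le> \<phi> x s" if "x \<in> F" for x
      using mono[OF that st(1,2) s\<eta>[OF that]] .
    have \<Phi>: "\<Phi> (Suc k) - \<Phi> (Suc (Suc k)) = (\<Sum>x\<in>F. \<phi> x s - \<phi> x t)"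
      by (simp add: \<Phi>_def s_def t_def sum_subtractf)
    have "a * (d (Suc k))\<^sup>2 \<le> b * d k * (\<Phi> (Suc k) - \<Phi> (Suc (Suc k)))"
    proof (cases "s = 0")
      \<comment> \<open>At the limit level the KL inequality says nothing, but the sufficient
        decrease already forces \<open>d (Suc k)\<close> to vanish.\<close>
      case True
      have "0 \<le> \<Phi> (Suc k) - \<Phi> (Suc (Suc k))"
        unfolding \<Phi> using le by (intro sum_nonneg) simp
      then have "0 \<le> b * d k * (\<Phi> (Suc k) - \<Phi> (Suc (Suc k)))"
        using b d by simp
      then show ?thesis
        using st True by linarith
    next
      case False
      then have s: "0 < s" using st by simp
      \<comment> \<open>The covering index \<open>j\<close> depends on \<open>k\<close>. The
        decrease of \<open>\<phi> j\<close> is at most that of the whole sum, because no summand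
        increases.\<close>
      obtain j where j: "j \<in> F" "u (Suc k) \<in> U j"
        using N(1)[of "Suc k"] k by auto
      have pos: "0 < \<phi>' j s"
        using KLF(4)[OF j(1) s s\<eta>[OF j(1)]] .
      have "1 \<le> ereal (\<phi>' j s) * edist_set 0 (limiting_subdiff f (u (Suc k)))"
        using KLF(6)[OF j(1,2) f] s s\<eta>[OF j(1)] by (simp add: s_def)
      also have "\<dots> \<le> ereal (\<phi>' j s) * ereal (b * d k)"
        using dist[of k] k N(3) pos by (intro ereal_mult_left_mono) auto
      finally have 1: "1 \<le> \<phi>' j s * (b * d k)"
        by (simp add: one_ereal_def)
      have "\<phi>' j s * (a * (d (Suc k))\<^sup>2) \<le> \<phi>' j s * (s - t)"
        using pos st by (intro mult_left_mono) auto
      also have "\<dots> \<le> \<phi> j s - \<phi> j t"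
        using KLF(5)[OF j(1) s s\<eta>[OF j(1)], of t] st s\<eta>[OF j(1)] by auto
      also have "\<dots> \<le> \<Phi> (Suc k) - \<Phi> (Suc (Suc k))"
        unfolding \<Phi> using le by (intro member_le_sum[OF j(1)] F) auto
      finally have "(b * d k) * (\<phi>' j s * (a * (d (Suc k))\<^sup>2)) \<le> (b * d k) * (\<Phi> (Suc k) - \<Phi> (Suc (Suc k)))"
        using b d by (intro mult_left_mono) auto
      moreover have "1 * (a * (d (Suc k))\<^sup>2) \<le> \<phi>' j s * (b * d k) * (a * (d (Suc k))\<^sup>2)"
        using 1 a by (intro mult_right_mono) auto
      ultimately show ?thesis
        by (simp add: mult_ac)
    qed
    then have "(d (Suc k))\<^sup>2 \<le> d k * (b / a * (\<Phi> (Suc k) - \<Phi> (Suc (Suc k))))"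
      using a by (simp add: field_simps)
    moreover define p where "p = b / a * (\<Phi> (Suc k) - \<Phi> (Suc (Suc k)))"
    ultimately have "(2 * d (Suc k))\<^sup>2 \<le> 4 * (d k * p)"
      by (simp add: power2_eq_square)
    \<comment> \<open>The inequality of arithmetic and geometric means, which trades the product for
      the sum required by the telescoping lemma.\<close>
    also have "\<dots> \<le> (d k + p)\<^sup>2"
      using zero_le_power2[of "d k - p"] by (simp add: power2_sum power2_diff mult_ac)
    finally have "(2 * d (Suc k))\<^sup>2 \<le> (d k + p)\<^sup>2" .
    moreover have "0 \<le> p"
      unfolding p_def \<Phi> using a b le by (intro mult_nonneg_nonneg sum_nonneg) auto
    ultimately have "2 * d (Suc k) \<le> d k + p"
      using d[of k] by (auto intro: power2_le_imp_le[of _ "d k + p"])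
    then show ?thesis
      by (simp add: p_def algebra_simps)
  qed
  \<comment> \<open>The potential is shifted by one because the subgradient at
    \<open>u (Suc k)\<close> is controlled by the preceding step \<open>d k\<close>.\<close>
  show ?thesis
    using d step \<Phi>_nonneg a b
    by (intro summable_if_double_le_telescoping[of d N "\<lambda>k. b / a * \<Phi> (Suc k)"]) auto
qed

section \<open>Subdifferentials of smooth perturbations\<close>

text \<open>Clearing the positive denominator replaces the lower limit of an extended-real quotient
  by real affine lower bounds with error \<open>e * norm (y - x)\<close>.\<close>

lemma frechet_subdiff_iff:
  assumes "f x = ereal c"
  shows "v \<in> frechet_subdiff f x \<longleftrightarrow>
    (\<forall>e>0. \<forall>\<^sub>F y in at x. ereal (c + v \<bullet> (y - x) - e * norm (y - x)) \<le> f y)"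
proof -
  let ?q = "\<lambda>y. (f y - f x - ereal (v \<bullet> (y - x))) / ereal (norm (y - x))"
  have q: "ereal (c + v \<bullet> (y - x) - e * norm (y - x)) \<le> f y \<longleftrightarrow> ereal (- e) \<le> ?q y"
    if "y \<noteq> x" for e y
    using that assms by (cases "f y") (auto simp: field_simps)
  have "v \<in> frechet_subdiff f x \<longleftrightarrow> (\<forall>r<0. \<forall>\<^sub>F y in at x. r < ?q y)"
    using assms by (simp add: frechet_subdiff_def edom_def le_Liminf_iff)
  also have "\<dots> \<longleftrightarrow> (\<forall>e>0. \<forall>\<^sub>F y in at x. ereal (- e) \<le> ?q y)"
  proof safe
    fix e :: real assume "\<forall>r<0. \<forall>\<^sub>F y in at x. r < ?q y" "0 < e"
    moreover from \<open>0 < e\<close> have "ereal (- e) < 0"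
      by simp
    ultimately have "\<forall>\<^sub>F y in at x. ereal (- e) < ?q y"
      by blast
    then show "\<forall>\<^sub>F y in at x. ereal (- e) \<le> ?q y"
      by (rule eventually_mono) (rule less_imp_le)
  next
    fix r :: ereal assume e: "\<forall>e>0. \<forall>\<^sub>F y in at x. ereal (- e) \<le> ?q y" and r: "r < 0"
    \<comment> \<open>The bound \<open>r\<close> may be \<open>-\<infinity>\<close>, so a real
      number between \<open>r\<close> and 0 takes its place.\<close>
    obtain m where m: "r < ereal m" "ereal m < 0"
      using ereal_dense2[OF r] by blast
    then have "\<forall>\<^sub>F y in at x. ereal (- (- m)) \<le> ?q y"
      using e by (intro e[rule_format]) simp
    then show "\<forall>\<^sub>F y in at x. r < ?q y"
      by (rule eventually_mono) (use m in auto)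
  qed
  also have "\<dots> \<longleftrightarrow> (\<forall>e>0. \<forall>\<^sub>F y in at x. ereal (c + v \<bullet> (y - x) - e * norm (y - x)) \<le> f y)"
    by (intro all_cong eventually_cong) (use q in \<open>auto simp: eventually_at_filter\<close>)
  finally show ?thesis .
qed

text \<open>The error \<open>e\<close> is split evenly between the lower bound for \<open>f\<close>
  and the first-order expansion of \<open>g\<close>.\<close>

lemma frechet_subdiff_add_smooth:
  fixes f :: "'a::real_inner \<Rightarrow> ereal"
  assumes v: "v \<in> frechet_subdiff f x" and fx: "f x = ereal c" and g: "GDERIV g x :> d"
    and eq: "\<forall>\<^sub>F y in nhds x. F y = f y + ereal (g y)"
  shows "v + d \<in> frechet_subdiff F x"
proof -
  have Fx: "F x = ereal (c + g x)"
    using eventually_nhds_x_imp_x[OF eq] fx by simp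
  have "\<forall>\<^sub>F y in at x. ereal (c + g x + (v + d) \<bullet> (y - x) - e * norm (y - x)) \<le> F y" if e: "e > 0" for e
  proof -
    have 1: "\<forall>\<^sub>F y in at x. ereal (c + v \<bullet> (y - x) - e / 2 * norm (y - x)) \<le> f y"
      using v e unfolding frechet_subdiff_iff[of f, OF fx] by (metis half_gt_zero)
    have 2: "\<forall>\<^sub>F y in at x. norm (g y - g x - (y - x) \<bullet> d) \<le> e / 2 * norm (y - x)"
      using g e half_gt_zero unfolding gderiv_def has_derivative_within_alt2 by blast
    have 3: "\<forall>\<^sub>F y in at x. F y = f y + ereal (g y)"
      using eq by (simp add: eventually_nhds_conv_at)
    from 1 2 3 show ?thesis
    proof eventually_elim
      case (elim y)
      have "g x + d \<bullet> (y - x) - e / 2 * norm (y - x) \<le> g y"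
        using elim(2) unfolding real_norm_def inner_commute[of _ d] by linarith
      then show ?case
        using elim(1) unfolding elim(3) by (cases "f y") (auto simp: algebra_simps)
    qed
  qed
  then show ?thesis
    unfolding frechet_subdiff_iff[of F, OF Fx] by blast
qed

text \<open>The Frechet rule is applied along the approximating sequence, and continuity of the
  gradient \<open>d\<close> carries the sum to the limit. A tail of the sequence lies in
  \<open>W\<close>.\<close>

lemma limiting_subdiff_add_smooth:
  fixes f :: "'a::real_inner \<Rightarrow> ereal"
  assumes v: "v \<in> limiting_subdiff f x" and W: "open W" "x \<in> W"
    and fin: "\<And>y. y \<in> W \<Longrightarrow> f y \<noteq> -\<infinity>" and eq: "\<And>y. y \<in> W \<Longrightarrow> F y = f y + ereal (g y)"
    and g: "\<And>y. y \<in> W \<Longrightarrow> GDERIV g y :> d y" and d: "continuous_on W d"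
  shows "v + d x \<in> limiting_subdiff F x"
proof -
  from v obtain xs vs where x: "x \<in> edom f" and xs: "xs \<longlonglongrightarrow> x" "(\<lambda>i. f (xs i)) \<longlonglongrightarrow> f x"
    and vs: "\<And>i. vs i \<in> frechet_subdiff f (xs i)" "vs \<longlonglongrightarrow> v"
    by (auto simp: limiting_subdiff_def)
  obtain N where N: "\<And>i. i \<ge> N \<Longrightarrow> xs i \<in> W"
    using topological_tendstoD[OF xs(1) W] by (auto simp: eventually_sequentially)
  let ?xs = "\<lambda>i. xs (i + N)" and ?vs = "\<lambda>i. vs (i + N)"
  have xs': "?xs \<longlonglongrightarrow> x" "(\<lambda>i. f (?xs i)) \<longlonglongrightarrow> f x" "?vs \<longlonglongrightarrow> v"
    using xs vs(2) by (auto intro: LIMSEQ_ignore_initial_segment)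
  have W': "?xs i \<in> W" for i
    using N by simp
  have "isCont g x"
    using g[OF W(2)] has_derivative_continuous unfolding gderiv_def by blast
  then have "(\<lambda>i. ereal (g (?xs i))) \<longlonglongrightarrow> ereal (g x)"
    by (intro tendsto_ereal isCont_tendsto_compose[OF _ xs'(1)])
  then have "(\<lambda>i. f (?xs i) + ereal (g (?xs i))) \<longlonglongrightarrow> f x + ereal (g x)"
    using xs'(2) x fin[OF W(2)] by (intro tendsto_add_ereal) (auto simp: edom_def)
  then have "(\<lambda>i. F (?xs i)) \<longlonglongrightarrow> F x"
    using eq W' W(2) by simp
  moreover have "(\<lambda>i. ?vs i + d (?xs i)) \<longlonglongrightarrow> v + d x"
    using d W(2) continuous_on_eq_continuous_at[OF W(1)]
    by (intro tendsto_add xs'(3) isCont_tendsto_compose[OF _ xs'(1), of d]) auto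
  moreover have "?vs i + d (?xs i) \<in> frechet_subdiff F (?xs i)" for i
  proof -
    have "?xs i \<in> edom f"
      using vs(1)[of "i + N"] by (simp add: frechet_subdiff_def)
    then obtain c where "f (?xs i) = ereal c"
      using fin[OF W'[of i]] by (cases "f (?xs i)") (auto simp: edom_def)
    moreover have "\<forall>\<^sub>F y in nhds (?xs i). F y = f y + ereal (g y)"
      using eventually_nhds_in_open[OF W(1) W'[of i]] by (rule eventually_mono) (rule eq)
    ultimately show ?thesis
      using vs(1) g[OF W'[of i]] by (intro frechet_subdiff_add_smooth)
  qed
  moreover have "x \<in> edom F"
    using x eq[OF W(2)] by (cases "f x") (auto simp: edom_def)
  ultimately show ?thesis
    using xs'(1) unfolding limiting_subdiff_def
    by (intro CollectI conjI exI[of _ ?xs] exI[of _ "\<lambda>i. ?vs i + d (?xs i)"]) auto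
qed

section \<open>Adjoint derivatives, local Lipschitz maps and lower semicontinuity\<close>

lemma GDERIV_compose_adjoint:
  fixes \<rho> :: "'a::euclidean_space \<Rightarrow> 'b::euclidean_space"
  assumes "(\<rho> has_derivative \<rho>') (at x)" "GDERIV f (\<rho> x) :> d"
  shows "GDERIV (\<lambda>y. f (\<rho> y)) x :> adjoint \<rho>' d"
  using has_derivative_compose[OF assms(1) assms(2)[unfolded gderiv_def]]
    adjoint_works[OF has_derivative_linear[OF assms(1)]]
  by (simp add: gderiv_def)

lemma linear_blinfun_apply: "linear (blinfun_apply A)"
  by (rule bounded_linear.linear[OF blinfun.bounded_linear_right])

text \<open>Moving the adjoint across the inner product writes the squared norm of
  \<open>adjoint A w\<close> as \<open>A (adjoint A w) \<bullet> w\<close>; one factor of the norm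
  then cancels.\<close>

lemma norm_adjoint_blinfun_le:
  fixes A :: "'a::euclidean_space \<Rightarrow>\<^sub>L 'b::euclidean_space"
  shows "norm (adjoint A w) \<le> norm A * norm w"
proof -
  let ?y = "adjoint A w"
  have "norm ?y * norm ?y = A ?y \<bullet> w"
    using adjoint_works[OF linear_blinfun_apply, of ?y A w]
    by (simp add: dot_square_norm power2_eq_square)
  also have "\<dots> \<le> norm (A ?y) * norm w"
    by (rule norm_cauchy_schwarz)
  also have "\<dots> \<le> norm A * norm ?y * norm w"
    by (intro mult_right_mono norm_blinfun) auto
  finally show ?thesis
    by (cases "norm ?y = 0") (auto simp: mult_ac)
qed

text \<open>Expanding in the orthonormal basis removes the adjoint and leaves sums of continuous
  terms.\<close>

lemma continuous_on_adjoint_blinfun: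
  fixes A :: "'c::topological_space \<Rightarrow> 'a::euclidean_space \<Rightarrow>\<^sub>L 'b::euclidean_space"
  assumes "continuous_on S A" "continuous_on S w"
  shows "continuous_on S (\<lambda>y. adjoint (A y) (w y))"
proof -
  have "adjoint (A y) (w y) = (\<Sum>b\<in>Basis. (A y b \<bullet> w y) *\<^sub>R b)" for y
    using euclidean_representation[of "adjoint (A y) (w y)"]
    by (simp add: inner_commute[of "adjoint _ _"] adjoint_works[OF linear_blinfun_apply])
  then show ?thesis
    using assms by (auto intro!: continuous_intros)
qed

text \<open>The map is viewed as a family constant in a time parameter ranging over
  \<open>{0}\<close>, to which the compactness theorem for \<open>local_lipschitz\<close>
  applies.\<close>

lemma locally_lipschitz_on_compact:
  assumes f: "locally_lipschitz_on S f" and K: "compact K" "K \<subseteq> S"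
  obtains L where "L-lipschitz_on K f"
proof -
  have "local_lipschitz {0::real} K (\<lambda>_. f)"
  proof (rule local_lipschitzI)
    fix x t assume "x \<in> K"
    then obtain e L where e: "e > 0" "L-lipschitz_on (ball x e \<inter> S) f"
      using f K by (force simp: locally_lipschitz_on_def)
    have "cball x (e / 2) \<inter> K \<subseteq> ball x e \<inter> S"
      using e(1) K by auto
    then have "L-lipschitz_on (cball x (e / 2) \<inter> K) f"
      using e(2) lipschitz_on_subset by blast
    then show "\<exists>u>0. \<exists>L. \<forall>t\<in>cball t u \<inter> {0}. L-lipschitz_on (cball x u \<inter> K) f"
      using e(1) half_gt_zero by blast
  qed
  then show thesis
    by (rule local_lipschitz_compact_implies_lipschitz[OF _ K(1), of "{0::real}" "\<lambda>_. f"]) (auto intro: that)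
qed

lemma locally_lipschitz_on_continuous:
  assumes "locally_lipschitz_on S f" "open S"
  shows "continuous_on S f"
  unfolding continuous_on_eq_continuous_at[OF assms(2)]
proof
  fix x assume x: "x \<in> S"
  then obtain e L where e: "e > 0" "L-lipschitz_on (ball x e \<inter> S) f"
    using assms by (auto simp: locally_lipschitz_on_def)
  then have "continuous_on (ball x e \<inter> S) f"
    by (intro lipschitz_on_continuous_on)
  then show "isCont f x"
    using x e(1) assms(2) by (auto simp: continuous_on_eq_continuous_at open_Int)
qed

lemma lower_semicontinuous_seq_le:
  assumes f: "lower_semicontinuous f" and x: "xs \<longlonglongrightarrow> x"
    and le: "\<forall>\<^sub>F n in sequentially. f (xs n) \<le> ereal (b n)" and b: "b \<longlonglongrightarrow> B"
  shows "f x \<le> ereal B"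
proof (rule ccontr)
  assume "\<not> f x \<le> ereal B"
  then obtain m where m: "ereal B < ereal m" "ereal m < f x"
    using ereal_dense2[of "ereal B" "f x"] by (metis not_le)
  then have "\<forall>\<^sub>F y in at x. ereal m < f y"
    using f unfolding lower_semicontinuous_def le_Liminf_iff by blast
  \<comment> \<open>The bound on the punctured neighbourhood is extended to \<open>x\<close>, since
    terms of the sequence may equal \<open>x\<close>.\<close>
  with m(2) have "\<forall>\<^sub>F y in nhds x. ereal m < f y"
    by (simp add: eventually_nhds_conv_at)
  then have "\<forall>\<^sub>F n in sequentially. ereal m < f (xs n)"
    using x by (rule eventually_compose_filterlim)
  moreover have "\<forall>\<^sub>F n in sequentially. b n < m"
    using b m(1) by (intro order_tendstoD(2)) simp_all
  ultimately have "\<forall>\<^sub>F n in sequentially. False"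
    using le
  proof eventually_elim
    case (elim n)
    then have "ereal m < ereal (b n)" by (meson less_le_trans)
    with elim(2) show ?case by simp
  qed
  then show False by simp
qed

section \<open>Convergence of the iterates\<close>

lemma objective_eq:
  assumes "proper G" "\<rho> v \<in> edom G"
  shows "objective G R \<rho> v = ereal (real_of_ereal (G (\<rho> v))) + R v"
  using proper_ereal[OF assms] by (simp add: objective_def)

text \<open>Everything but \<open>R v\<close> is finite here, so the extended-real arithmetic is
  confined to one final addition.\<close>

lemma surrogate_eq:
  assumes "proper h" "proper G" "edom h \<subseteq> edom G" "\<rho> w \<in> interior (edom h)" "\<rho> v \<in> edom h"
  shows "surrogate \<tau> h G R \<rho> w v =
    ereal (1 / \<tau> * (real_of_ereal (h (\<rho> v)) - real_of_ereal (h (\<rho> w)) - egrad h (\<rho> w) \<bullet> (\<rho> v - \<rho> w))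
      + real_of_ereal (G (\<rho> w)) + egrad G (\<rho> w) \<bullet> (\<rho> v - \<rho> w)) + R v"
proof -
  have w: "\<rho> w \<in> edom h"
    using assms(4) interior_subset by blast
  obtain a b c where "h (\<rho> v) = ereal a" "h (\<rho> w) = ereal b" "G (\<rho> w) = ereal c"
    using proper_finite[OF assms(1)] proper_finite[OF assms(2)] assms(3,5) w by (meson subsetD)
  then show ?thesis
    using assms(4) by (simp add: surrogate_def bregman_def)
qed

theorem theorem2:
  fixes C :: "(real ^ 'm) set"
    and h G :: "real ^ 'm \<Rightarrow> ereal"
    and R E :: "real ^ 'n \<Rightarrow> ereal"
    and \<rho> :: "real ^ 'n \<Rightarrow> real ^ 'm"
    and L \<tau> :: real
    and u :: "nat \<Rightarrow> real ^ 'n"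
  defines "E \<equiv> objective G R \<rho>"
  assumes C: "closed C" "convex C" "interior C \<noteq> {}"
    and h: "proper h" "lower_semicontinuous h" "econvex h" "essentially_smooth h"
      "closure (edom h) = C"
    and G: "proper G" "lower_semicontinuous G" "edom h \<subseteq> edom G"
      "\<forall>x\<in>interior (edom h). ediff G x"
    and R: "proper R" "lower_semicontinuous R" "edom R \<inter> \<rho> -` interior (edom h) \<noteq> {}"
    and \<rho>: "continuous_on UNIV \<rho>"
    and step_size: "0 < \<tau>"
    and A_E: "bounded_from_below E" "coercive E"
    and A_L: "0 < L"
      "convex_on (interior (edom h)) (\<lambda>x. L * real_of_ereal (h x) - real_of_ereal (G x))"
    and A_init: "u 0 \<in> \<rho> -` interior (edom h) \<inter> edom E"
    and A_iter: "\<forall>k. surrogate \<tau> h G R \<rho> (u k) (u (Suc k)) \<le> surrogate \<tau> h G R \<rho> (u k) (u k) \<and>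
        surrogate \<tau> h G R \<rho> (u k) (u k) = E (u k) \<and>
        u (Suc k) \<in> \<rho> -` interior (edom h)"
    and B_E: "continuous_on (edom E) E" "\<forall>x\<in>accum u. KL_property E x"
    and B_h: "\<exists>\<mu>>0. strongly_convex_on (interior (edom h)) \<mu> (\<lambda>x. real_of_ereal (h x))"
    and B_\<rho>: "continuously_differentiable \<rho>"
    and B_lipschitz: "locally_lipschitz_on (interior (edom h))
        (\<lambda>x. (1 / \<tau>) *\<^sub>R egrad h x - egrad G x)"
    and B_Z: "closure {\<rho> (u k) | k. k \<ge> 1} \<subseteq> interior (edom h)"
    and B_stationary: "\<forall>k. 0 \<in> limiting_subdiff (surrogate \<tau> h G R \<rho> (u k)) (u (Suc k))"
    and B_step: "\<tau> < 1 / L"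
    and global_opt: "\<forall>k v. surrogate \<tau> h G R \<rho> (u k) (u (Suc k)) \<le> surrogate \<tau> h G R \<rho> (u k) v"
  shows "\<exists>z. (\<lambda>k. \<rho> (u k)) \<longlonglongrightarrow> z \<and> z \<in> interior (edom h) \<and>
           (\<forall>x\<in>accum u. R_minimizing R \<rho> z x) \<and>
           ((\<exists>!x. R_minimizing R \<rho> z x) \<longrightarrow> convergent u)"
proof -
  define S where "S = interior (edom h)"
  define hr where "hr = (\<lambda>y. real_of_ereal (h y))"
  define Gr where "Gr = (\<lambda>y. real_of_ereal (G y))"
  define q where "q = (\<lambda>y. (1 / \<tau>) *\<^sub>R egrad h y - egrad G y)"
  define z where "z = (\<lambda>k. \<rho> (u k))"
  define D where "D = (\<lambda>p y. hr p - hr y - egrad h y \<bullet> (p - y))"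
  have "open S" and S_dom: "\<And>y. y \<in> S \<Longrightarrow> y \<in> edom h"
    using interior_subset by (auto simp: S_def)
  have zS: "z k \<in> S" for k
    using A_init A_iter by (cases k) (auto simp: z_def S_def)
  have hD: "GDERIV hr y :> egrad h y" if "y \<in> S" for y
    using essentially_smooth_GDERIV(1)[OF h(1,3,4)] that by (simp add: S_def hr_def)
  have GD: "GDERIV Gr y :> egrad G y" if "y \<in> S" for y
    using ediff_GDERIV[of G y] G(4) that by (simp add: S_def Gr_def)
  obtain \<mu> where \<mu>: "0 < \<mu>" "strongly_convex_on S \<mu> hr"
    using B_h by (auto simp: S_def hr_def)
  have D_ge: "\<mu> / 2 * (norm (p - y))\<^sup>2 \<le> D p y" if "p \<in> S" "y \<in> S" for p y
    using strongly_convex_on_gradient_ineq[OF \<mu>(2) that(2,1) hD[OF that(2)]] by (simp add: D_def)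
  have D_nonneg: "0 \<le> D p y" if "p \<in> S" "y \<in> S" for p y
    using D_ge[OF that] \<mu>(1) by (smt (verit) mult_nonneg_nonneg zero_le_power2 divide_nonneg_pos)
  have G_le: "Gr p \<le> Gr y + egrad G y \<bullet> (p - y) + L * D p y" if "p \<in> S" "y \<in> S" for p y
  proof -
    have "GDERIV (\<lambda>y. L * hr y - Gr y) y :> L *\<^sub>R egrad h y - egrad G y"
      using hD[OF that(2)] GD[OF that(2)] unfolding gderiv_def
      by (auto intro!: derivative_eq_intros simp: inner_diff_right)
    moreover have "convex_on S (\<lambda>y. L * hr y - Gr y)"
      using A_L(2) by (simp add: S_def hr_def Gr_def)
    ultimately have "L * hr y - Gr y + (L *\<^sub>R egrad h y - egrad G y) \<bullet> (p - y) \<le> L * hr p - Gr p"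
      using that by (intro convex_on_gradient_ineq)
    then show ?thesis
      by (simp add: D_def algebra_simps)
  qed
  have q: "continuous_on S q"
    using locally_lipschitz_on_continuous[OF B_lipschitz] by (simp add: S_def q_def)
  have sur: "surrogate \<tau> h G R \<rho> (u k) v =
      ereal (1 / \<tau> * D (\<rho> v) (z k) + Gr (z k) + egrad G (z k) \<bullet> (\<rho> v - z k)) + R v"
    if "\<rho> v \<in> S" for k v
    using surrogate_eq[where \<rho>=\<rho> and w="u k" and v=v, OF h(1) G(1,3)] zS[of k] S_dom[OF that]
    by (simp add: D_def z_def hr_def Gr_def S_def)
  have E_eq: "E v = ereal (Gr (\<rho> v)) + R v" if "\<rho> v \<in> S" for v
    using objective_eq[where \<rho>=\<rho> and v=v, OF G(1) subsetD[OF G(3) S_dom[OF that]]]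
    by (simp add: E_def Gr_def)
  have R_MInf: "R v \<noteq> -\<infinity>" for v
    using R(1) by (simp add: proper_def)

  \<comment> \<open>Sufficient decrease and boundedness of the iterates\<close>
  define a where "a = (1 / \<tau> - L) * (\<mu> / 2)"
  have "L < 1 / \<tau>"
    using B_step step_size A_L(1) by (simp add: field_simps)
  then have a: "0 < a"
    using \<mu>(1) by (simp add: a_def)
  define d where "d = (\<lambda>k. norm (z (Suc k) - z k))"
  have descent: "E (u (Suc k)) + ereal (a * (d k)\<^sup>2) \<le> E (u k)" for k
  proof -
    \<comment> \<open>The majorisation of \<open>G\<close> consumes \<open>L\<close> times the
      Bregman distance out of the weight \<open>1 / \<tau>\<close>; strong convexity bounds the
      remainder from below.\<close>
    have "a * (d k)\<^sup>2 \<le> (1 / \<tau> - L) * D (z (Suc k)) (z k)"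
      using mult_left_mono[OF D_ge[OF zS zS, of "Suc k" k], of "1 / \<tau> - L"] \<open>L < 1 / \<tau>\<close>
      by (simp add: a_def d_def mult.assoc)
    then have "Gr (z (Suc k)) + a * (d k)\<^sup>2
        \<le> 1 / \<tau> * D (z (Suc k)) (z k) + Gr (z k) + egrad G (z k) \<bullet> (z (Suc k) - z k)"
      using G_le[OF zS zS, of "Suc k" k] by (simp add: left_diff_distrib)
    then have "E (u (Suc k)) + ereal (a * (d k)\<^sup>2) \<le> surrogate \<tau> h G R \<rho> (u k) (u (Suc k))"
      using zS[of "Suc k"] by (cases "R (u (Suc k))") (auto simp: sur E_eq z_def algebra_simps)
    also have "\<dots> \<le> E (u k)"
      using A_iter by metis
    finally show ?thesis .
  qed
  have E_dec: "E (u (Suc k)) \<le> E (u k)" for k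
  proof -
    have "E (u (Suc k)) + 0 \<le> E (u (Suc k)) + ereal (a * (d k)\<^sup>2)"
      using a by (intro add_left_mono) simp
    then show ?thesis
      using descent[of k] by (metis add.right_neutral order_trans)
  qed
  then have E_le: "E (u k) \<le> E (u 0)" for k
    by (induction k) (auto intro: order_trans)
  have E0: "E (u 0) < \<infinity>"
    using A_init by (simp add: edom_def)
  define e where "e = (\<lambda>k. real_of_ereal (E (u k)))"
  have e: "E (u k) = ereal (e k)" for k
  proof -
    have "E (u k) \<noteq> -\<infinity>"
      using E_eq[of "u k"] zS[of k] R_MInf[of "u k"] by (simp add: z_def)
    moreover have "E (u k) \<noteq> \<infinity>"
      using E_le[of k] E0 by auto
    ultimately show ?thesis
      by (cases "E (u k)") (auto simp: e_def)
  qed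
  \<comment> \<open>Coercivity puts the sublevel set of \<open>E\<close> at \<open>u 0\<close>, and
    with it all iterates, into the ball of radius \<open>B\<close>.\<close>
  have "\<forall>\<^sub>F x in at_infinity. E (u 0) < E x"
    using A_E(2) E0 unfolding coercive_def by (rule order_tendstoD(1))
  then obtain B where B: "\<And>x. B \<le> norm x \<Longrightarrow> E (u 0) < E x"
    by (auto simp: eventually_at_infinity)
  have u_cball: "u k \<in> cball 0 B" for k
    using B[of "u k"] E_le[of k] by (auto simp: not_less[symmetric])
  then have bdd: "bounded (range u)"
    using bounded_subset[OF bounded_cball[of 0 B], of "range u"] by blast

  \<comment> \<open>Subgradient bound and convergence of the outer sequence\<close>
  define Z where "Z = closure {\<rho> (u k) | k. k \<ge> 1}"
  have "compact (\<rho> ` cball 0 B)"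
    using \<rho> by (intro compact_continuous_image continuous_on_subset[OF \<rho>]) auto
  moreover have "{\<rho> (u k) | k. k \<ge> 1} \<subseteq> \<rho> ` cball 0 B"
    using u_cball by auto
  ultimately have "compact Z"
    unfolding Z_def by (meson bounded_subset compact_closure compact_imp_bounded)
  moreover have ZS: "Z \<subseteq> S"
    using B_Z by (simp add: Z_def S_def)
  ultimately obtain K where K: "K-lipschitz_on Z q"
    using locally_lipschitz_on_compact B_lipschitz unfolding S_def q_def by metis
  \<comment> \<open>\<open>Z\<close> is built from the indices \<open>k \<ge> 1\<close>, which is
    why the subgradient bound starts there and the KL lemma is applied with
    \<open>N0 = 1\<close>.\<close>
  have zZ: "z k \<in> Z" if "k \<ge> 1" for k
    unfolding Z_def z_def using that by (intro subsetD[OF closure_subset]) auto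
  obtain \<rho>' :: "real ^ 'n \<Rightarrow> (real ^ 'n) \<Rightarrow>\<^sub>L (real ^ 'm)"
    where \<rho>': "\<And>x. (\<rho> has_derivative \<rho>' x) (at x)" "continuous_on UNIV \<rho>'"
    using B_\<rho> by (auto simp: continuously_differentiable_def)
  have "bounded (\<rho>' ` cball 0 B)"
    by (intro compact_imp_bounded compact_continuous_image continuous_on_subset[OF \<rho>'(2)]) auto
  then obtain M where M: "0 < M" "\<And>x. x \<in> cball 0 B \<Longrightarrow> norm (\<rho>' x) \<le> M"
    unfolding bounded_pos by auto

  have subgrad: "adjoint (\<rho>' (u (Suc k))) (q (z k) - q (z (Suc k))) \<in> limiting_subdiff E (u (Suc k))" for k
  proof -
    let ?W = "\<rho> -` S"
    \<comment> \<open>\<open>g\<close> is the objective minus the surrogate as a function of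
      \<open>p = \<rho> y\<close>: the \<open>R\<close> terms cancel, and its gradient is a
      difference of values of the locally Lipschitz map \<open>q\<close>.\<close>
    define g where "g = (\<lambda>p. Gr p - (1 / \<tau> * D p (z k) + Gr (z k) + egrad G (z k) \<bullet> (p - z k)))"
    have g: "GDERIV g p :> q (z k) - q p" if "p \<in> S" for p
      using hD[OF that] GD[OF that] step_size unfolding gderiv_def g_def D_def
      by (auto intro!: derivative_eq_intros simp: q_def inner_commute algebra_simps)
    have "0 + adjoint (\<rho>' (u (Suc k))) (q (z k) - q (\<rho> (u (Suc k)))) \<in> limiting_subdiff E (u (Suc k))"
    proof (rule limiting_subdiff_add_smooth)
      show "0 \<in> limiting_subdiff (surrogate \<tau> h G R \<rho> (u k)) (u (Suc k))"
        using B_stationary by blast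
      show "open ?W"
        using \<rho> \<open>open S\<close> by (simp add: continuous_on_open_vimage)
      show "u (Suc k) \<in> ?W"
        using zS[of "Suc k"] by (simp add: z_def)
      fix y assume y: "y \<in> ?W"
      show "surrogate \<tau> h G R \<rho> (u k) y \<noteq> -\<infinity>"
        using y R_MInf[of y] by (simp add: sur)
      show "E y = surrogate \<tau> h G R \<rho> (u k) y + ereal (g (\<rho> y))"
        using y by (cases "R y") (auto simp: sur E_eq g_def)
      show "GDERIV (\<lambda>y. g (\<rho> y)) y :> adjoint (\<rho>' y) (q (z k) - q (\<rho> y))"
        using y by (intro GDERIV_compose_adjoint \<rho>' g) simp
    next
      show "continuous_on ?W (\<lambda>y. adjoint (\<rho>' y) (q (z k) - q (\<rho> y)))"
        by (intro continuous_on_adjoint_blinfun continuous_intros continuous_on_compose2[OF q]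
            continuous_on_subset[OF \<rho>'(2)] continuous_on_subset[OF \<rho>]) auto
    qed
    then show ?thesis
      by (simp add: z_def)
  qed
  have dist: "edist_set 0 (limiting_subdiff E (u (Suc k))) \<le> ereal (M * K * d k)" if k: "k \<ge> 1" for k
  proof -
    let ?v = "adjoint (\<rho>' (u (Suc k))) (q (z k) - q (z (Suc k)))"
    have "edist_set 0 (limiting_subdiff E (u (Suc k))) \<le> ereal (dist 0 ?v)"
      unfolding edist_set_def by (rule INF_lower[OF subgrad])
    also have "dist 0 ?v \<le> norm (\<rho>' (u (Suc k))) * norm (q (z k) - q (z (Suc k)))"
      using norm_adjoint_blinfun_le by simp
    also have "\<dots> \<le> M * (K * d k)"
      using lipschitz_onD[OF K zZ zZ, of k "Suc k"] k M u_cball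
      by (intro mult_mono) (auto simp: d_def dist_norm norm_minus_commute)
    finally show ?thesis
      by (simp add: mult.assoc)
  qed
  have "summable d"
  proof (rule KL_summable_steps)
    show "bounded (range u)" "bounded_from_below E" "continuous_on (edom E) E"
      "\<forall>x\<in>accum u. KL_property E x" "0 < a"
      using bdd A_E(1) B_E a by auto
    show "E (u k) = ereal (e k)" for k by (rule e)
    show "e (Suc k) + a * (d k)\<^sup>2 \<le> e k" for k
      using descent[of k] by (simp add: e)
    show "0 \<le> d k" for k by (simp add: d_def)
    show "edist_set 0 (limiting_subdiff E (u (Suc k))) \<le> ereal (M * K * d k)" if "k \<ge> 1" for k
      using that by (rule dist)
    show "0 \<le> M * K"
      using M(1) lipschitz_on_nonneg[OF K] by simp
  qed
  then have "summable (\<lambda>k. z (Suc k) - z k)"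
    unfolding d_def by (rule summable_norm_cancel)
  then have "convergent (\<lambda>n. z n - z 0)"
    by (simp add: summable_iff_convergent sum_lessThan_telescope)
  then have "convergent z"
    by (simp add: convergent_diff_const_right_iff)
  then obtain zs where zs: "z \<longlonglongrightarrow> zs"
    by (auto simp: convergent_def)
  have "\<forall>\<^sub>F k in sequentially. z k \<in> Z"
    using zZ eventually_sequentially by blast
  then have "zs \<in> Z"
    by (intro Lim_in_closed_set[OF _ _ _ zs]) (auto simp: Z_def)
  then have zsS: "zs \<in> S"
    using ZS by blast

  \<comment> \<open>Comparison with points of the limiting fibre\<close>
  \<comment> \<open>\<open>c k\<close> is what remains when the surrogate at
    \<open>u (Suc k)\<close> is compared with that at a point over \<open>zs\<close>: the
    \<open>G (z k)\<close> terms cancel and the nonnegative Bregman distance on the left is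
    dropped.\<close>
  define c where "c = (\<lambda>k. 1 / \<tau> * D zs (z k) + egrad G (z k) \<bullet> (zs - z (Suc k)))"
  have "c \<longlonglongrightarrow> 0"
  proof -
    have hz: "(\<lambda>k. hr (z k)) \<longlonglongrightarrow> hr zs"
      using hD[OF zsS] has_derivative_continuous unfolding gderiv_def
      by (intro isCont_tendsto_compose[OF _ zs]) blast
    \<comment> \<open>Essential smoothness bounds the gradients of \<open>h\<close> near
      \<open>zs\<close>, so their products with null sequences vanish.\<close>
    obtain r where r: "r > 0" "bounded (\<Union>y\<in>ball zs r. convex_subdiff h y)"
      using h(4) essentially_smooth_GDERIV(2)[OF h(1,3,4)] zsS
      unfolding essentially_smooth_def S_def by blast
    then obtain B1 where B1: "\<And>y v. y \<in> ball zs r \<Longrightarrow> v \<in> convex_subdiff h y \<Longrightarrow> norm v \<le> B1"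
      unfolding bounded_iff by blast
    have "\<forall>\<^sub>F k in sequentially. z k \<in> ball zs r"
      using r(1) zs by (intro topological_tendstoD[OF zs]) auto
    then have hb: "\<forall>\<^sub>F k in sequentially. norm (egrad h (z k)) \<le> B1"
      by (rule eventually_mono)
        (use B1 essentially_smooth_GDERIV(2)[OF h(1,3,4)] zS in \<open>auto simp: S_def\<close>)
    have null: "(\<lambda>k. egrad h (z k) \<bullet> w k) \<longlonglongrightarrow> 0" if w: "w \<longlonglongrightarrow> 0" for w :: "nat \<Rightarrow> real ^ 'm"
    proof (rule Lim_null_comparison)
      show "(\<lambda>k. B1 * norm (w k)) \<longlonglongrightarrow> 0"
        using tendsto_mult[OF tendsto_const tendsto_norm[OF w], of B1] by simp
      show "\<forall>\<^sub>F k in sequentially. norm (egrad h (z k) \<bullet> w k) \<le> B1 * norm (w k)"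
        using hb
      proof eventually_elim
        case (elim k)
        then show ?case
          using Cauchy_Schwarz_ineq2[of "egrad h (z k)" "w k"] mult_right_mono[OF elim, of "norm (w k)"]
          by simp
      qed
    qed
    have zs0: "(\<lambda>k. zs - z k) \<longlonglongrightarrow> 0" "(\<lambda>k. zs - z (Suc k)) \<longlonglongrightarrow> 0"
      using tendsto_diff[OF tendsto_const zs, of zs] tendsto_diff[OF tendsto_const LIMSEQ_Suc[OF zs], of zs] by auto
    have qz: "(\<lambda>k. q (z k)) \<longlonglongrightarrow> q zs"
      using q zsS continuous_on_eq_continuous_at[OF \<open>open S\<close>]
      by (intro isCont_tendsto_compose[OF _ zs]) blast
    \<comment> \<open>The gradient of \<open>G\<close> is written as \<open>1 / \<tau>\<close> times
      that of \<open>h\<close> minus \<open>q\<close>, so that boundedness of the former and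
      continuity of \<open>q\<close> give the limit.\<close>
    have "(\<lambda>k. 1 / \<tau> * (hr zs - hr (z k) - egrad h (z k) \<bullet> (zs - z k))
        + (1 / \<tau> * (egrad h (z k) \<bullet> (zs - z (Suc k))) - q (z k) \<bullet> (zs - z (Suc k))))
      \<longlonglongrightarrow> 1 / \<tau> * (hr zs - hr zs - 0) + (1 / \<tau> * 0 - q zs \<bullet> 0)"
      by (intro tendsto_add tendsto_mult tendsto_diff tendsto_inner tendsto_const hz null qz zs0)
    moreover have "c = (\<lambda>k. 1 / \<tau> * (hr zs - hr (z k) - egrad h (z k) \<bullet> (zs - z k))
        + (1 / \<tau> * (egrad h (z k) \<bullet> (zs - z (Suc k))) - q (z k) \<bullet> (zs - z (Suc k))))"
      by (simp add: c_def D_def q_def inner_diff_left)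
    ultimately show ?thesis by simp
  qed
  have R_le: "R (u (Suc k)) \<le> R v + ereal (c k)" if v: "\<rho> v = zs" for k v
  proof -
    have "surrogate \<tau> h G R \<rho> (u k) (u (Suc k)) \<le> surrogate \<tau> h G R \<rho> (u k) v"
      using global_opt by blast
    moreover have "\<rho> (u (Suc k)) = z (Suc k)" "z (Suc k) \<in> S" "\<rho> v \<in> S"
      using zS[of "Suc k"] zsS v by (auto simp: z_def)
    moreover have "0 \<le> 1 / \<tau> * D (z (Suc k)) (z k)"
      using D_nonneg[OF zS zS] step_size by simp
    ultimately show ?thesis
      using v R_MInf by (cases "R (u (Suc k))"; cases "R v") (auto simp: sur c_def inner_diff_right)
  qed
  have minim: "R_minimizing R \<rho> zs x" if x: "x \<in> accum u" for x
    unfolding R_minimizing_def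
  proof (intro conjI allI impI)
    obtain r where r: "strict_mono (r :: nat \<Rightarrow> nat)" "(u \<circ> r) \<longlonglongrightarrow> x"
      using x by (auto simp: accum_def)
    have "(\<lambda>n. \<rho> (u (r n))) \<longlonglongrightarrow> \<rho> x"
      using \<rho> r(2) by (auto simp: o_def continuous_on_eq_continuous_at intro: isCont_tendsto_compose)
    moreover have "(\<lambda>n. \<rho> (u (r n))) \<longlonglongrightarrow> zs"
      using LIMSEQ_subseq_LIMSEQ[OF zs r(1)] by (simp add: o_def z_def)
    ultimately show "\<rho> x = zs"
      by (rule LIMSEQ_unique)
    fix v assume v: "\<rho> v = zs"
    show "R x \<le> R v"
    proof (cases "R v")
      case (real m)
      \<comment> \<open>\<open>R_le\<close> bounds \<open>R\<close> at index \<open>Suc k\<close>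
        through \<open>c k\<close>, hence the shift; requiring \<open>r n \<ge> 1\<close> avoids the
        truncated subtraction at 0.\<close>
      have "(\<lambda>k. m + c (k - 1)) \<longlonglongrightarrow> m + 0"
        by (rule LIMSEQ_imp_Suc) (intro tendsto_intros, simp add: \<open>c \<longlonglongrightarrow> 0\<close>)
      then have lim: "(\<lambda>n. m + c (r n - 1)) \<longlonglongrightarrow> m"
        using LIMSEQ_subseq_LIMSEQ[OF _ r(1)] by (fastforce simp: o_def)
      have "R (u k) \<le> ereal (m + c (k - 1))" if "k \<ge> 1" for k
        using R_le[OF v, of "k - 1"] that real by simp
      moreover have "\<forall>\<^sub>F n in sequentially. r n \<ge> 1"
        using filterlim_subseq[OF r(1)] by (simp add: filterlim_at_top)
      ultimately have "\<forall>\<^sub>F n in sequentially. R ((u \<circ> r) n) \<le> ereal (m + c (r n - 1))"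
        by (auto elim: eventually_mono)
      then show ?thesis
        using lower_semicontinuous_seq_le[OF R(2) r(2) _ lim] real by simp
    qed (use R_MInf in auto)
  qed
  have "convergent u" if ex1: "\<exists>!x. R_minimizing R \<rho> zs x"
  proof -
    \<comment> \<open>All accumulation points are minimisers, so uniqueness puts them into
      \<open>{x}\<close>, and each neighbourhood of \<open>x\<close> contains a tail of the bounded
      sequence.\<close>
    obtain x where x: "accum u \<subseteq> {x}"
      using minim ex1 by auto
    have "u \<longlonglongrightarrow> x"
    proof (rule topological_tendstoI)
      fix U assume "open U" "x \<in> U"
      then show "\<forall>\<^sub>F k in sequentially. u k \<in> U"
        using x by (intro eventually_mem_open_if_accum_subset[OF bdd]) auto
    qed
    then show ?thesis
      by (rule convergentI)
  qed
  then show ?thesis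
    using zs zsS minim unfolding z_def S_def by blast
qed

end
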